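(* Let $P$ be a finite poset with $\hat 0$ and $\hat 1$, and let $F_1,\dots,F_N$ be a lexicographic order on the facets of the order complex $\Delta(P)$. Then each facet attachment changes at most one Betti number, and changes its value by at most one: for each $k$, there is at most one index $d$ with $b_d\bigl(\bigcup_{i\le k}F_i\bigr)\neq b_d\bigl(\bigcup_{i<k}F_i\bigr)$, and for such $d$ the two values differ by exactly $1$.
   Context: $\Delta(P)$ is the simplicial complex whose faces are the chains of $P\setminus\{\hat 0,\hat 1\}$. Its facets correspond to the saturated chains $\hat 0=u_0\prec u_1\prec\cdots\prec u_s=\hat 1$ of $P$ ($\prec$ denotes a covering relation); the facet has vertices $u_1,\dots,u_{s-1}$, and the rank of $u_i$ within that facet is $i$. $P$ is not assumed graded. A facet is also identified with the simplicial complex of all its faces, so $\bigcup_{i\le k}F_i$ denotes the subcomplex of $\Delta(P)$ of all faces contained in one of $F_1,\dots,F_k$. Lexicographic order: a total order on the facets of $\Delta(P)$ such that whenever facets $F,F'$ have the same elements at ranks $1,\dots,i$ (for some $i\ge 0$) but different elements at rank $i+1$, and $F$ precedes $F'$, then every facet containing the elements of $F$ at ranks $1,\dots,i+1$ precedes every facet containing the elements of $F'$ at ranks $1,\dots,i+1$. $b_d(\Delta)$ denotes the rank of the homology group $H_d(\Delta)$ (all zero for the complex with no faces). *)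

theory Defs
  imports "HOL-Algebra.Algebra" "HOL-Algebra.Free_Abelian_Groups"
begin

section \<open>Betti numbers of simplicial complexes\<close>

text \<open>
  A simplicial complex is represented by its set of faces; the empty face may be among them, and
  \<^term>\<open>{} :: 'a set set\<close> is the complex with no faces. Vertices come from a partially ordered
  type, and every face is supposed to be a finite chain. The order of the vertices then orients
  all faces: deleting the \<open>j\<close>-th smallest vertex (counted from 0) has sign \<open>(-1)^j\<close>.
\<close>

definition simplices :: "nat \<Rightarrow> 'a set set \<Rightarrow> 'a set set" where
  "simplices d K = {\<sigma> \<in> K. finite \<sigma> \<and> card \<sigma> = d + 1}"

text \<open>The empty face is ignored: this is ordinary (not reduced) homology with integer coefficients.\<close>

definition simplicial_boundary ::
    "nat \<Rightarrow> (('a::order) set \<Rightarrow>\<^sub>0 int) \<Rightarrow> ('a set \<Rightarrow>\<^sub>0 int)" where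
  "simplicial_boundary d c =
     (if d = 0 then 0
      else frag_extend
             (\<lambda>\<sigma>. \<Sum>v\<in>\<sigma>. frag_cmul ((-1) ^ card {u \<in> \<sigma>. u < v}) (frag_of (\<sigma> - {v}))) c)"

definition simplicial_chain_group :: "nat \<Rightarrow> 'a set set \<Rightarrow> ('a set \<Rightarrow>\<^sub>0 int) monoid" where
  "simplicial_chain_group d K = free_Abelian_group (simplices d K)"

definition simplicial_cycles :: "nat \<Rightarrow> ('a::order) set set \<Rightarrow> ('a set \<Rightarrow>\<^sub>0 int) set" where
  "simplicial_cycles d K =
     {c \<in> carrier (simplicial_chain_group d K). simplicial_boundary d c = 0}"

definition simplicial_boundaries :: "nat \<Rightarrow> ('a::order) set set \<Rightarrow> ('a set \<Rightarrow>\<^sub>0 int) set" where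
  "simplicial_boundaries d K =
     simplicial_boundary (d + 1) ` carrier (simplicial_chain_group (d + 1) K)"

definition simplicial_homology_group ::
    "nat \<Rightarrow> ('a::order) set set \<Rightarrow> ('a set \<Rightarrow>\<^sub>0 int) set monoid" where
  "simplicial_homology_group d K =
     subgroup_generated (simplicial_chain_group d K) (simplicial_cycles d K)
       Mod simplicial_boundaries d K"

definition int_independent :: "('g, 'm) monoid_scheme \<Rightarrow> 'g set \<Rightarrow> bool" where
  "int_independent G S \<longleftrightarrow>
     finite S \<and> S \<subseteq> carrier G \<and>
     (\<forall>n :: 'g \<Rightarrow> int. finprod G (\<lambda>x. x [^]\<^bsub>G\<^esub> n x) S = \<one>\<^bsub>G\<^esub> \<longrightarrow> (\<forall>x\<in>S. n x = 0))"

text \<open>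
  The (torsion-free) rank of an abelian group. It is meaningful only for groups of finite rank,
  such as the homology groups of finite complexes; otherwise the \<^const>\<open>Max\<close> is unspecified.
\<close>

definition abelian_rank :: "('g, 'm) monoid_scheme \<Rightarrow> nat" where
  "abelian_rank G = Max {card S | S. int_independent G S}"

definition betti_number :: "nat \<Rightarrow> ('a::order) set set \<Rightarrow> nat" where
  "betti_number d K = abelian_rank (simplicial_homology_group d K)"


section \<open>Order complexes and lexicographic orders\<close>

text \<open>
  The finite bounded poset \<open>P\<close> is the universe of a type of classes \<^class>\<open>finite\<close>,
  \<^class>\<open>order_bot\<close> and \<^class>\<open>order_top\<close>.
\<close>

definition order_complex :: "('a::{finite, order_bot, order_top}) set set" where
  "order_complex = {\<sigma>. \<sigma> \<subseteq> UNIV - {bot, Orderings.top} \<and> Complete_Partial_Order.chain (\<le>) \<sigma>}"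

definition facets :: "'a set set \<Rightarrow> 'a set set" where
  "facets K = {F \<in> K. \<forall>G\<in>K. F \<subseteq> G \<longrightarrow> F = G}"

text \<open>
  If \<open>bot = u\<^sub>0 < u\<^sub>1 < \<dots> < u\<^sub>s = top\<close> is the saturated chain of the facet
  \<open>F = {u\<^sub>1, \<dots>, u\<^bsub>s-1\<^esub>}\<close>, the set below is \<open>{u\<^sub>i}\<close> for \<open>1 \<le> i < s\<close>, and it is empty for
  all other \<open>i\<close>.
\<close>

definition at_rank :: "('a::order) set \<Rightarrow> nat \<Rightarrow> 'a set" where
  "at_rank F i = {u \<in> F. card {v \<in> F. v \<le> u} = i}"

text \<open>
  The total order on the facets of \<open>\<Delta>(P)\<close> is given as a repetition-free enumeration
  \<open>F 1, \<dots>, F N\<close>.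
\<close>

definition lexicographic_order ::
    "nat \<Rightarrow> (nat \<Rightarrow> ('a::{finite, order_bot, order_top}) set) \<Rightarrow> bool" where
  "lexicographic_order N F \<longleftrightarrow>
     bij_betw F {1..N} (facets order_complex) \<and>
     (\<forall>a\<in>{1..N}. \<forall>b\<in>{1..N}. \<forall>i.
        a < b \<and>
        (\<forall>j\<in>{1..i}. at_rank (F a) j = at_rank (F b) j) \<and>
        at_rank (F a) (i + 1) \<noteq> at_rank (F b) (i + 1) \<longrightarrow>
        (\<forall>c\<in>{1..N}. \<forall>d\<in>{1..N}.
           (\<Union>j\<in>{1..i + 1}. at_rank (F a) j) \<subseteq> F c \<and>
           (\<Union>j\<in>{1..i + 1}. at_rank (F b) j) \<subseteq> F d \<longrightarrow> c < d))"

end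

theory Submission
  imports Defs "HOL-Analysis.Cartesian_Space"
begin

text \<open>
  A face of \<open>F k\<close> lies in an earlier facet iff it misses one of the intervals \<open>J\<close> of \<open>F k\<close> for which
  \<open>F k - J\<close> lies in an earlier facet: if \<open>F a\<close> branches off from \<open>F k\<close> and next meets it in \<open>w\<close>, then
  following \<open>F a\<close> up to \<open>w\<close> and \<open>F k\<close> from there on gives a facet that precedes \<open>F k\<close> and skips
  an interval of \<open>F k\<close> only. So the new faces are the sets that hit every such interval. They can be
  matched by repeatedly using the interval with the least right end point \<open>b\<close>, leaving at most one
  face unmatched. Attaching a matched pair changes no Betti number, and attaching a single cell
  either creates or kills one class.
\<close>

section \<open>Ranks of free abelian groups\<close>

definition frag_vec :: "('b::finite \<Rightarrow>\<^sub>0 int) \<Rightarrow> rat ^ 'b" where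
  "frag_vec c = (\<chi> i. of_int (Poly_Mapping.lookup c i))"

lemma frag_vec_0 [simp]: "frag_vec 0 = 0"
  by (simp add: frag_vec_def vec_eq_iff)

lemma frag_vec_add: "frag_vec (c + d) = frag_vec c + frag_vec d"
  by (simp add: frag_vec_def vec_eq_iff lookup_add)

lemma frag_vec_diff: "frag_vec (c - d) = frag_vec c - frag_vec d"
  by (simp add: frag_vec_def vec_eq_iff lookup_minus)

lemma frag_vec_cmul: "frag_vec (frag_cmul n c) = of_int n *s frag_vec c"
  by (simp add: frag_vec_def vec_eq_iff)

lemma frag_vec_of: "frag_vec (frag_of b) = axis b 1"
  by (simp add: frag_vec_def vec_eq_iff axis_def)

lemma frag_vec_inject [simp]: "frag_vec c = frag_vec d \<longleftrightarrow> c = d"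
  by (auto simp: frag_vec_def vec_eq_iff intro: poly_mapping_eqI)

definition frag_submodule :: "('b \<Rightarrow>\<^sub>0 int) set \<Rightarrow> bool" where
  "frag_submodule M \<longleftrightarrow> 0 \<in> M \<and> (\<forall>x\<in>M. \<forall>y\<in>M. x + y \<in> M) \<and> (\<forall>n. \<forall>x\<in>M. frag_cmul n x \<in> M)"

lemma frag_submodule_0: "frag_submodule M \<Longrightarrow> 0 \<in> M"
  and frag_submodule_add: "frag_submodule M \<Longrightarrow> x \<in> M \<Longrightarrow> y \<in> M \<Longrightarrow> x + y \<in> M"
  and frag_submodule_cmul: "frag_submodule M \<Longrightarrow> x \<in> M \<Longrightarrow> frag_cmul n x \<in> M"
  by (auto simp: frag_submodule_def)

lemma frag_submodule_uminus: "frag_submodule M \<Longrightarrow> x \<in> M \<Longrightarrow> - x \<in> M"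
  using frag_submodule_cmul[of M x "-1"] by simp

lemma frag_submodule_diff: "frag_submodule M \<Longrightarrow> x \<in> M \<Longrightarrow> y \<in> M \<Longrightarrow> x - y \<in> M"
  using frag_submodule_add[of M x "- y"] frag_submodule_uminus[of M y] by simp

lemma frag_submodule_sum:
  assumes "frag_submodule M" "\<And>i. i \<in> I \<Longrightarrow> f i \<in> M"
  shows "sum f I \<in> M"
  using assms(2)
  by (induction I rule: infinite_finite_induct)
     (auto intro: frag_submodule_add frag_submodule_0 assms(1))

lemma frag_submodule_free: "frag_submodule (carrier (free_Abelian_group S))"
  unfolding frag_submodule_def by (auto dest!: subsetD[OF keys_add])

lemma span_frag_vec_multiple:
  assumes M: "frag_submodule M" and x: "x \<in> vec.span (frag_vec ` M)"
  shows "\<exists>m::int. m \<noteq> 0 \<and> (\<exists>c\<in>M. of_int m *s x = frag_vec c)"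
  using x
proof (induction rule: vec.span_induct_alt)
  case base
  show ?case
    by (intro exI[of _ 1] conjI bexI[of _ 0]) (auto simp: frag_submodule_0[OF M])
next
  case (step q v y)
  from step.hyps obtain c where c: "c \<in> M" "v = frag_vec c" by auto
  from step.IH obtain m :: int and d where d: "m \<noteq> 0" "d \<in> M" "of_int m *s y = frag_vec d" by auto
  obtain a b :: int where q: "q = of_int a / of_int b" "b \<noteq> 0"
    by (metis Rat_cases of_int_rat divide_eq_0_iff Fract_of_int_quotient less_irrefl)
  have "of_int (b * m) *s (q *s v + y) = of_int (a * m) *s v + of_int b *s (of_int m *s y)"
    using q(2) by (simp add: q(1) vec.scale_right_distrib field_simps)
  also have "\<dots> = frag_vec (frag_cmul (a * m) c + frag_cmul b d)"
    by (simp add: d(3) c(2) frag_vec_add frag_vec_cmul)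
  finally show ?case
    using q(2) d(1,2) c(1)
    by (intro exI[of _ "b * m"] conjI bexI[of _ "frag_cmul (a * m) c + frag_cmul b d"])
       (auto intro!: frag_submodule_add[OF M] frag_submodule_cmul[OF M])
qed

definition frag_rank :: "('b::finite \<Rightarrow>\<^sub>0 int) set \<Rightarrow> nat" where
  "frag_rank M = vec.dim (frag_vec ` M)"

definition independent_mod :: "('b \<Rightarrow>\<^sub>0 int) set \<Rightarrow> ('b \<Rightarrow>\<^sub>0 int) set \<Rightarrow> bool" where
  "independent_mod B T \<longleftrightarrow>
     finite T \<and> (\<forall>n. (\<Sum>t\<in>T. frag_cmul (n t) t) \<in> B \<longrightarrow> (\<forall>t\<in>T. n t = 0))"

lemma independent_modD:
  "independent_mod B T \<Longrightarrow> (\<Sum>t\<in>T. frag_cmul (n t) t) \<in> B \<Longrightarrow> t \<in> T \<Longrightarrow> n t = 0"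
  by (auto simp: independent_mod_def)

lemma independent_mod_insert:
  assumes t: "t \<notin> T" and ind: "independent_mod B (insert t T)"
  shows "independent_mod B T"
  unfolding independent_mod_def
proof (intro conjI allI impI ballI)
  show fin: "finite T" using ind by (simp add: independent_mod_def)
  fix n s assume n: "(\<Sum>t\<in>T. frag_cmul (n t) t) \<in> B" and s: "s \<in> T"
  have "(\<Sum>u\<in>insert t T. frag_cmul ((n(t := 0)) u) u) = (\<Sum>u\<in>T. frag_cmul ((n(t := 0)) u) u)"
    using t fin by simp
  also have "\<dots> = (\<Sum>u\<in>T. frag_cmul (n u) u)"
    using t by (intro sum.cong) auto
  finally have "(n(t := 0)) s = 0"
    using n s by (intro independent_modD[OF ind]) auto
  thus "n s = 0" using s t by (auto split: if_splits)
qed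

lemma frag_submodule_combinations:
  assumes B: "frag_submodule B" and fin: "finite T"
  shows "frag_submodule {b + (\<Sum>t\<in>T. frag_cmul (n t) t) | b n. b \<in> B}" (is "frag_submodule ?M")
  unfolding frag_submodule_def
proof (intro conjI ballI allI)
  show "0 \<in> ?M"
    by (rule CollectI, intro exI[of _ 0] exI[of _ "\<lambda>_. 0"]) (auto simp: frag_submodule_0[OF B])
next
  fix x y assume "x \<in> ?M" "y \<in> ?M"
  then obtain b n b' n' where *: "x = b + (\<Sum>t\<in>T. frag_cmul (n t) t)" "b \<in> B"
    "y = b' + (\<Sum>t\<in>T. frag_cmul (n' t) t)" "b' \<in> B" by blast
  have "x + y = (b + b') + (\<Sum>t\<in>T. frag_cmul (n t + n' t) t)"
    by (simp add: * frag_cmul_distrib sum.distrib)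
  thus "x + y \<in> ?M" using *(2,4) frag_submodule_add[OF B]
    by (intro CollectI exI[of _ "b + b'"] exI[of _ "\<lambda>t. n t + n' t"]) auto
next
  fix k x assume "x \<in> ?M"
  then obtain b n where *: "x = b + (\<Sum>t\<in>T. frag_cmul (n t) t)" "b \<in> B" by blast
  have "frag_cmul k x = frag_cmul k b + (\<Sum>t\<in>T. frag_cmul (k * n t) t)"
    by (simp add: * frag_cmul_distrib2 frag_cmul_sum)
  thus "frag_cmul k x \<in> ?M" using *(2) frag_submodule_cmul[OF B]
    by (intro CollectI exI[of _ "frag_cmul k b"] exI[of _ "\<lambda>t. k * n t"]) auto
qed

lemma independent_mod_frag_rank:
  assumes B: "frag_submodule B" and ind: "independent_mod B T"
  shows "frag_rank (B \<union> T) = frag_rank B + card T"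
proof -
  have "finite T" using ind by (simp add: independent_mod_def)
  thus ?thesis using ind
  proof (induction T rule: finite_induct)
    case empty
    show ?case by simp
  next
    case (insert t T)
    let ?M = "{b + (\<Sum>t\<in>T. frag_cmul (n t) t) | b n. b \<in> B}"
    have ind': "independent_mod B T"
      using independent_mod_insert insert.hyps insert.prems by blast
    have M: "frag_submodule ?M"
      by (rule frag_submodule_combinations[OF B insert.hyps(1)])
    have "B \<union> T \<subseteq> ?M"
    proof
      fix x assume "x \<in> B \<union> T"
      thus "x \<in> ?M"
      proof
        assume "x \<in> B"
        thus ?thesis by (intro CollectI exI[of _ x] exI[of _ "\<lambda>_. 0"]) auto
      next
        assume x: "x \<in> T"
        have "(\<Sum>t\<in>T. frag_cmul (if t = x then 1 else 0) t) = (\<Sum>t\<in>T. if t = x then x else 0)"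
          by (intro sum.cong) auto
        also have "\<dots> = x" using x insert.hyps(1) by simp
        finally show ?thesis
          by (intro CollectI exI[of _ 0] exI[of _ "\<lambda>t. if t = x then 1 else 0"])
             (auto simp: frag_submodule_0[OF B])
      qed
    qed
    hence sub: "vec.span (frag_vec ` (B \<union> T)) \<subseteq> vec.span (frag_vec ` ?M)"
      by (intro vec.span_mono image_mono)
    have "frag_vec t \<notin> vec.span (frag_vec ` (B \<union> T))"
    proof
      assume "frag_vec t \<in> vec.span (frag_vec ` (B \<union> T))"
      hence "frag_vec t \<in> vec.span (frag_vec ` ?M)" using sub by blast
      then obtain m :: int and c where m: "m \<noteq> 0" "c \<in> ?M" "of_int m *s frag_vec t = frag_vec c"
        using span_frag_vec_multiple[OF M] by blast
      from m(2) obtain b n where c: "c = b + (\<Sum>t\<in>T. frag_cmul (n t) t)" "b \<in> B" by blast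
      have "frag_cmul m t = c" using m(3) by (simp flip: frag_vec_cmul)
      hence b: "b = frag_cmul m t - (\<Sum>t\<in>T. frag_cmul (n t) t)" using c(1) by simp
      let ?n = "\<lambda>u. if u = t then m else - n u"
      have "(\<Sum>u\<in>insert t T. frag_cmul (?n u) u) = frag_cmul m t + (\<Sum>u\<in>T. frag_cmul (?n u) u)"
        using insert.hyps by simp
      also have "(\<Sum>u\<in>T. frag_cmul (?n u) u) = (\<Sum>u\<in>T. - frag_cmul (n u) u)"
        using insert.hyps(2) by (intro sum.cong) auto
      finally have "(\<Sum>u\<in>insert t T. frag_cmul (?n u) u) = b" by (simp only: b sum_negf) simp
      hence "?n t = 0" using c(2) by (intro independent_modD[OF insert.prems]) auto
      thus False using m(1) by simp
    qed
    hence "frag_rank (insert t (B \<union> T)) = frag_rank (B \<union> T) + 1"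
      by (simp add: frag_rank_def vec.dim_insert)
    thus ?case using insert.IH[OF ind'] insert.hyps by simp
  qed
qed

lemma frag_rank_mono: "A \<subseteq> B \<Longrightarrow> frag_rank A \<le> frag_rank B"
  unfolding frag_rank_def by (intro vec.dim_subset image_mono)

lemma exists_independent_mod:
  assumes B: "frag_submodule B" and Z: "frag_submodule Z" and BZ: "B \<subseteq> Z"
  shows "\<exists>T\<subseteq>Z. independent_mod B T \<and> frag_rank B + card T = frag_rank Z"
proof -
  have "\<exists>T\<subseteq>Z. independent_mod B T \<and> card T = k" if "frag_rank B + k \<le> frag_rank Z" for k
    using that
  proof (induction k)
    case 0
    show ?case by (intro exI[of _ "{}"]) (auto simp: independent_mod_def)
  next
    case (Suc k)
    then obtain T where T: "T \<subseteq> Z" "independent_mod B T" "card T = k" by auto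
    have fin: "finite T" using T(2) by (simp add: independent_mod_def)
    have "frag_rank (B \<union> T) < frag_rank Z"
      using independent_mod_frag_rank[OF B T(2)] Suc.prems T(3) by simp
    hence "\<not> frag_vec ` Z \<subseteq> vec.span (frag_vec ` (B \<union> T))"
      using vec.dim_mono[of "frag_vec ` Z" "frag_vec ` (B \<union> T)"]
      unfolding frag_rank_def by linarith
    then obtain z where z: "z \<in> Z" "frag_vec z \<notin> vec.span (frag_vec ` (B \<union> T))" by blast
    hence zT: "z \<notin> T" by (meson imageI UnCI vec.span_base)
    have "independent_mod B (insert z T)"
      unfolding independent_mod_def
    proof (intro conjI allI impI)
      show "finite (insert z T)" using fin by simp
      fix n assume n: "(\<Sum>t\<in>insert z T. frag_cmul (n t) t) \<in> B" (is "?b \<in> B")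
      have b: "?b = frag_cmul (n z) z + (\<Sum>t\<in>T. frag_cmul (n t) t)"
        using fin zT by simp
      have sum: "frag_vec (\<Sum>t\<in>T. frag_cmul (n t) t) \<in> vec.span (frag_vec ` (B \<union> T))"
      proof -
        have "frag_vec (\<Sum>t\<in>U. frag_cmul (n t) t) \<in> vec.span (frag_vec ` (B \<union> T))"
          if "finite U" "U \<subseteq> T" for U
          using that
        proof (induction U rule: finite_induct)
          case (insert u U)
          thus ?case
            by (simp add: frag_vec_add frag_vec_cmul vec.span_add vec.span_scale vec.span_base)
        qed (simp add: vec.span_zero)
        thus ?thesis using fin by blast
      qed
      have "frag_vec ?b \<in> vec.span (frag_vec ` (B \<union> T))" using n by (intro vec.span_base) auto
      hence "frag_vec ?b - frag_vec (\<Sum>t\<in>T. frag_cmul (n t) t) \<in> vec.span (frag_vec ` (B \<union> T))"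
        using sum by (rule vec.span_diff)
      hence "of_int (n z) *s frag_vec z \<in> vec.span (frag_vec ` (B \<union> T))"
        unfolding b by (simp add: frag_vec_add frag_vec_cmul)
      from vec.span_scale[OF this, of "inverse (of_int (n z))"]
      have nz: "n z = 0"
        using z(2) by (cases "n z = 0") simp_all
      hence "(\<Sum>t\<in>T. frag_cmul (n t) t) \<in> B" using n b by simp
      thus "\<forall>t\<in>insert z T. n t = 0" using nz independent_modD[OF T(2)] by blast
    qed
    thus ?case using z(1) T zT fin by (intro exI[of _ "insert z T"]) auto
  qed
  from this[of "frag_rank Z - frag_rank B"] frag_rank_mono[OF BZ] show ?thesis
    by (metis le_add_diff_inverse order_refl)
qed

lemma independent_mod_card_le:
  assumes "frag_submodule B" "independent_mod B T" "B \<subseteq> Z" "T \<subseteq> Z"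
  shows "frag_rank B + card T \<le> frag_rank Z"
  using independent_mod_frag_rank[OF assms(1,2)] frag_rank_mono[of "B \<union> T" Z] assms(3,4) by simp

lemma frag_submodule_image:
  assumes M: "frag_submodule M"
    and add: "\<And>x y. f (x + y) = f x + f y" and cmul: "\<And>n x. f (frag_cmul n x) = frag_cmul n (f x)"
  shows "frag_submodule (f ` M)"
proof -
  have "\<forall>x\<in>f ` M. \<forall>y\<in>f ` M. x + y \<in> f ` M"
    using frag_submodule_add[OF M] by (auto simp flip: add)
  moreover have "\<forall>n. \<forall>x\<in>f ` M. frag_cmul n x \<in> f ` M"
    using frag_submodule_cmul[OF M] by (auto simp flip: cmul)
  moreover have "0 \<in> f ` M"
    using cmul[of 0 0] frag_submodule_0[OF M] by force
  ultimately show ?thesis unfolding frag_submodule_def by blast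
qed

lemma rank_nullity:
  assumes M: "frag_submodule M"
    and add: "\<And>x y. f (x + y) = f x + f y" and cmul: "\<And>n x. f (frag_cmul n x) = frag_cmul n (f x)"
  shows "frag_rank {c \<in> M. f c = 0} + frag_rank (f ` M) = frag_rank M"
proof -
  let ?Z = "{c \<in> M. f c = 0}"
  have f0: "f 0 = 0" using cmul[of 0 0] by simp
  have Z: "frag_submodule ?Z"
    using M by (auto simp: frag_submodule_def add cmul f0)
  have fM: "frag_submodule (f ` M)" by (rule frag_submodule_image[OF M add cmul])
  have zero: "frag_submodule {0 :: 'b \<Rightarrow>\<^sub>0 int}" "frag_rank {0 :: 'b \<Rightarrow>\<^sub>0 int} = 0"
    by (auto simp: frag_submodule_def frag_rank_def)
  have fsum: "f (\<Sum>t\<in>T. frag_cmul (n t) t) = (\<Sum>t\<in>T. frag_cmul (n t) (f t))" for T n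
    by (induction T rule: infinite_finite_induct) (auto simp: f0 add cmul)
  have *: "independent_mod ?Z T \<longleftrightarrow> independent_mod {0} (f ` T)"
    if T: "T \<subseteq> M" "inj_on f T" "finite T" for T
  proof -
    have "(\<Sum>t\<in>T. frag_cmul (n t) t) \<in> M" for n
      using T(1) by (intro frag_submodule_sum[OF M] frag_submodule_cmul[OF M]) auto
    hence Z: "(\<Sum>t\<in>T. frag_cmul (n t) t) \<in> ?Z \<longleftrightarrow> (\<Sum>t\<in>T. frag_cmul (n t) (f t)) = 0" for n
      by (simp add: fsum)
    have "(\<Sum>s\<in>f ` T. frag_cmul (n s) s) = (\<Sum>t\<in>T. frag_cmul (n (f t)) (f t))" for n
      using T(2) by (simp add: sum.reindex)
    hence "independent_mod {0} (f ` T) \<longleftrightarrow>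
        (\<forall>n. (\<Sum>t\<in>T. frag_cmul (n (f t)) (f t)) = 0 \<longrightarrow> (\<forall>t\<in>T. n (f t) = 0))"
      using T(3) by (simp add: independent_mod_def)
    also have "\<dots> \<longleftrightarrow> (\<forall>n. (\<Sum>t\<in>T. frag_cmul (n t) (f t)) = 0 \<longrightarrow> (\<forall>t\<in>T. n t = 0))"
    proof (intro iffI allI impI)
      fix n assume *: "\<forall>n. (\<Sum>t\<in>T. frag_cmul (n (f t)) (f t)) = 0 \<longrightarrow> (\<forall>t\<in>T. n (f t) = 0)"
        and n: "(\<Sum>t\<in>T. frag_cmul (n t) (f t)) = 0"
      have inv: "inv_into T f (f t) = t" if "t \<in> T" for t using that T(2) by simp
      have "(\<Sum>t\<in>T. frag_cmul (n (inv_into T f (f t))) (f t)) = (\<Sum>t\<in>T. frag_cmul (n t) (f t))"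
        using inv by (intro sum.cong) auto
      thus "\<forall>t\<in>T. n t = 0" using *[rule_format, of "\<lambda>s. n (inv_into T f s)"] n inv by auto
    next
      fix n assume *: "\<forall>n. (\<Sum>t\<in>T. frag_cmul (n t) (f t)) = 0 \<longrightarrow> (\<forall>t\<in>T. n t = 0)"
        and n: "(\<Sum>t\<in>T. frag_cmul (n (f t)) (f t)) = 0"
      show "\<forall>t\<in>T. n (f t) = 0" using *[rule_format, of "\<lambda>t. n (f t)"] n by simp
    qed
    finally show ?thesis using T(3) Z unfolding independent_mod_def by simp
  qed
  obtain T where T: "T \<subseteq> M" "independent_mod ?Z T" "frag_rank ?Z + card T = frag_rank M"
    using exists_independent_mod[OF Z M] by auto
  have fin: "finite T" using T(2) by (simp add: independent_mod_def)
  have inj: "inj_on f T"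
  proof (rule inj_onI, rule ccontr)
    fix s t assume st: "s \<in> T" "t \<in> T" "f s = f t" "s \<noteq> t"
    let ?n = "\<lambda>u. if u = s then 1 else if u = t then - 1 else 0 :: int"
    have "(\<Sum>u\<in>T. frag_cmul (?n u) u) = (\<Sum>u\<in>{s, t}. frag_cmul (?n u) u)"
      using st fin by (intro sum.mono_neutral_right) auto
    also have "\<dots> = s - t" using st(4) by simp
    finally have "(\<Sum>u\<in>T. frag_cmul (?n u) u) \<in> ?Z"
      using st T(1) add[of "s - t" t] by (auto intro!: frag_submodule_diff[OF M])
    from independent_modD[OF T(2) this st(1)] show False by simp
  qed
  have "independent_mod {0} (f ` T)" using * T inj fin by blast
  from independent_mod_card_le[OF zero(1) this, of "f ` M"]
  have 1: "card T \<le> frag_rank (f ` M)"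
    using T(1) zero(2) card_image[OF inj] frag_submodule_0[OF fM] by auto
  obtain U where U: "U \<subseteq> f ` M" "independent_mod {0} U" "card U = frag_rank (f ` M)"
    using exists_independent_mod[OF zero(1) fM] zero(2) frag_submodule_0[OF fM] by auto
  obtain T' where T': "T' \<subseteq> M" "inj_on f T'" "U = f ` T'"
    using U(1) by (meson subset_image_inj)
  have "finite T'" using U(2) T' by (auto simp: independent_mod_def finite_image_iff)
  hence "independent_mod ?Z T'" using * T' U by blast
  from independent_mod_card_le[OF Z this, of M]
  have "frag_rank ?Z + frag_rank (f ` M) \<le> frag_rank M"
    using T' U(3) card_image[OF T'(2)] by auto
  with 1 T(3) show ?thesis by simp
qed

lemma int_independent_cosets:
  fixes S :: "'b set" and Z B
  defines "G \<equiv> subgroup_generated (free_Abelian_group S) Z"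
  assumes Z: "frag_submodule Z" "Z \<subseteq> carrier (free_Abelian_group S)"
    and B: "frag_submodule B" "B \<subseteq> Z"
  shows "carrier (G Mod B) = (\<lambda>z. B #>\<^bsub>G\<^esub> z) ` Z"
    and "T \<subseteq> Z \<Longrightarrow> inj_on (\<lambda>z. B #>\<^bsub>G\<^esub> z) T \<Longrightarrow>
      int_independent (G Mod B) ((\<lambda>z. B #>\<^bsub>G\<^esub> z) ` T) \<longleftrightarrow> independent_mod B T"
    and "x \<in> Z \<Longrightarrow> y \<in> Z \<Longrightarrow> B #>\<^bsub>G\<^esub> x = B #>\<^bsub>G\<^esub> y \<Longrightarrow> x - y \<in> B"
proof -
  let ?F = "free_Abelian_group S"
  interpret F: comm_group ?F by (rule abelian_free_Abelian_group)
  have sub: "subgroup M ?F" if "frag_submodule M" "M \<subseteq> carrier ?F" for M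
  proof (rule F.subgroupI)
    show "M \<noteq> {}" using frag_submodule_0[OF that(1)] by blast
  next
    fix a assume "a \<in> M"
    thus "inv\<^bsub>?F\<^esub> a \<in> M" using that frag_submodule_uminus[OF that(1)]
      by (metis carrier_free_Abelian_group_iff inv_free_Abelian_group subsetD)
  next
    fix a b assume "a \<in> M" "b \<in> M"
    thus "a \<otimes>\<^bsub>?F\<^esub> b \<in> M" using frag_submodule_add[OF that(1)] by simp
  qed (use that in auto)
  have carG: "carrier G = Z"
    unfolding G_def using sub[OF Z] by (rule subgroup.carrier_subgroup_generated_subgroup)
  interpret G: comm_group G
    unfolding G_def by (rule F.abelian_subgroup_generated) (rule F.comm_group_axioms)
  have multG: "x \<otimes>\<^bsub>G\<^esub> y = x + y" for x y unfolding G_def by simp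
  have oneG: "\<one>\<^bsub>G\<^esub> = 0" unfolding G_def by simp
  have powG: "x [^]\<^bsub>G\<^esub> n = frag_cmul n x" if "x \<in> Z" for x and n :: int
    using that Z(2) carG by (auto simp: G_def F.int_pow_subgroup_generated)
  have subB: "subgroup B G"
  proof (rule G.subgroupI)
    show "B \<subseteq> carrier G" using B carG by simp
    show "B \<noteq> {}" using frag_submodule_0[OF B(1)] by blast
  next
    fix a assume a: "a \<in> B"
    have "inv\<^bsub>G\<^esub> a = - a"
      by (rule G.inv_equality) (use a B Z frag_submodule_uminus in \<open>auto simp: carG multG oneG\<close>)
    thus "inv\<^bsub>G\<^esub> a \<in> B" using frag_submodule_uminus[OF B(1) a] by simp
  next
    fix a b assume "a \<in> B" "b \<in> B"
    thus "a \<otimes>\<^bsub>G\<^esub> b \<in> B" using frag_submodule_add[OF B(1)] by (simp add: multG)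
  qed
  interpret H: comm_group "G Mod B" using G.abelian_FactGroup[OF subB] .
  interpret N: normal B G using G.subgroup_imp_normal[OF subB] .
  define \<pi> where "\<pi> = (\<lambda>z. B #>\<^bsub>G\<^esub> z)"
  have hom: "\<pi> \<in> hom G (G Mod B)" unfolding \<pi>_def by (rule N.r_coset_hom_Mod)
  interpret P: group_hom G "G Mod B" \<pi> by unfold_locales (rule hom)
  show carH: "carrier (G Mod B) = (\<lambda>z. B #>\<^bsub>G\<^esub> z) ` Z"
    by (simp add: carrier_FactGroup carG)
  have \<pi>_one: "\<pi> z = B \<longleftrightarrow> z \<in> B" if "z \<in> Z" for z
    using that G.coset_join1[OF _ _ subB, of z] G.coset_join2[OF _ subB, of z] carG B(2) unfolding \<pi>_def
    by auto
  show "x - y \<in> B" if "x \<in> Z" "y \<in> Z" "B #>\<^bsub>G\<^esub> x = B #>\<^bsub>G\<^esub> y"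
  proof -
    have "x \<in> B #>\<^bsub>G\<^esub> y" using G.rcos_self[of x B] that subB carG by auto
    thus ?thesis by (auto simp: r_coset_def multG)
  qed
  show "int_independent (G Mod B) ((\<lambda>z. B #>\<^bsub>G\<^esub> z) ` T) \<longleftrightarrow> independent_mod B T"
    if T: "T \<subseteq> Z" "inj_on (\<lambda>z. B #>\<^bsub>G\<^esub> z) T"
  proof -
    have inj: "inj_on \<pi> T" using T(2) by (simp add: \<pi>_def)
    have fp: "finprod (G Mod B) (\<lambda>t. \<pi> t [^]\<^bsub>G Mod B\<^esub> (n t :: int)) U
              = \<pi> (\<Sum>t\<in>U. frag_cmul (n t) t)" if "finite U" "U \<subseteq> T" for U n
      using that
    proof (induction U rule: finite_induct)
      case empty
      show ?case using P.hom_one oneG by simp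
    next
      case (insert u U)
      have u: "u \<in> Z" using insert.prems T(1) by blast
      have "(\<Sum>t\<in>U. frag_cmul (n t) t) \<in> Z"
        using insert.prems T(1) by (intro frag_submodule_sum[OF Z(1)] frag_submodule_cmul[OF Z(1)]) auto
      moreover have "frag_cmul (n u) u \<in> Z" using u by (rule frag_submodule_cmul[OF Z(1)])
      moreover have "\<pi> u [^]\<^bsub>G Mod B\<^esub> n u = \<pi> (frag_cmul (n u) u)"
        using P.hom_int_pow[of u "n u"] u carG powG by simp
      ultimately show ?case
        using insert P.hom_mult[of "frag_cmul (n u) u" "\<Sum>t\<in>U. frag_cmul (n t) t"] T(1) carG
        by (subst H.finprod_insert) (auto simp: multG intro!: H.int_pow_closed)
    qed
    have *: "finprod (G Mod B) (\<lambda>x. x [^]\<^bsub>G Mod B\<^esub> (n x :: int)) (\<pi> ` T) = \<one>\<^bsub>G Mod B\<^esub>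
        \<longleftrightarrow> (\<Sum>t\<in>T. frag_cmul (n (\<pi> t)) t) \<in> B" if "finite T" for n
    proof -
      have "finprod (G Mod B) (\<lambda>x. x [^]\<^bsub>G Mod B\<^esub> (n x :: int)) (\<pi> ` T)
          = finprod (G Mod B) (\<lambda>t. \<pi> t [^]\<^bsub>G Mod B\<^esub> (n (\<pi> t))) T"
        using T(1) inj carG by (subst H.finprod_reindex) (auto intro!: H.int_pow_closed)
      also have "\<dots> = \<pi> (\<Sum>t\<in>T. frag_cmul (n (\<pi> t)) t)"
        using fp[OF that, of "\<lambda>t. n (\<pi> t)"] by simp
      finally show ?thesis using T(1)
        by (simp add: \<pi>_one frag_submodule_sum[OF Z(1)] frag_submodule_cmul[OF Z(1)] subset_iff)
    qed
    have "int_independent (G Mod B) (\<pi> ` T) \<longleftrightarrow>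
       finite T \<and> (\<forall>n. (\<Sum>t\<in>T. frag_cmul (n (\<pi> t)) t) \<in> B \<longrightarrow> (\<forall>t\<in>T. n (\<pi> t) = 0))"
      using inj T(1) carH * unfolding int_independent_def
      by (auto simp: finite_image_iff \<pi>_def[symmetric])
    also have "(\<forall>n. (\<Sum>t\<in>T. frag_cmul (n (\<pi> t)) t) \<in> B \<longrightarrow> (\<forall>t\<in>T. n (\<pi> t) = 0)) \<longleftrightarrow>
       (\<forall>n. (\<Sum>t\<in>T. frag_cmul (n t) t) \<in> B \<longrightarrow> (\<forall>t\<in>T. n t = 0))"
    proof (intro iffI allI impI)
      fix n assume *: "\<forall>n. (\<Sum>t\<in>T. frag_cmul (n (\<pi> t)) t) \<in> B \<longrightarrow> (\<forall>t\<in>T. n (\<pi> t) = 0)"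
        and n: "(\<Sum>t\<in>T. frag_cmul (n t) t) \<in> B"
      have inv: "inv_into T \<pi> (\<pi> t) = t" if "t \<in> T" for t using that inj by simp
      have "(\<Sum>t\<in>T. frag_cmul (n (inv_into T \<pi> (\<pi> t))) t) = (\<Sum>t\<in>T. frag_cmul (n t) t)"
        using inv by (intro sum.cong) auto
      thus "\<forall>t\<in>T. n t = 0" using *[rule_format, of "\<lambda>s. n (inv_into T \<pi> s)"] n inv by auto
    next
      fix n assume *: "\<forall>n. (\<Sum>t\<in>T. frag_cmul (n t) t) \<in> B \<longrightarrow> (\<forall>t\<in>T. n t = 0)"
        and n: "(\<Sum>t\<in>T. frag_cmul (n (\<pi> t)) t) \<in> B"
      show "\<forall>t\<in>T. n (\<pi> t) = 0" using *[rule_format, of "\<lambda>t. n (\<pi> t)"] n by simp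
    qed
    finally show ?thesis unfolding independent_mod_def \<pi>_def .
  qed
qed

lemma abelian_rank_quotient:
  fixes S :: "'b::finite set"
  assumes Z: "frag_submodule Z" "Z \<subseteq> carrier (free_Abelian_group S)"
    and B: "frag_submodule B" "B \<subseteq> Z"
  shows "abelian_rank (subgroup_generated (free_Abelian_group S) Z Mod B) + frag_rank B = frag_rank Z"
proof -
  define G where "G = subgroup_generated (free_Abelian_group S) Z"
  let ?pi = "\<lambda>z. B #>\<^bsub>G\<^esub> z"
  note cos = int_independent_cosets[OF Z B, folded G_def]
  have bound: "card A \<le> frag_rank Z - frag_rank B" if A: "int_independent (G Mod B) A" for A
  proof -
    have "A \<subseteq> ?pi ` Z" using A cos(1) by (simp add: int_independent_def)
    then obtain T where T: "T \<subseteq> Z" "inj_on ?pi T" "A = ?pi ` T" by (meson subset_image_inj)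
    hence "independent_mod B T" using cos(2) A by blast
    from independent_mod_card_le[OF B(1) this B(2) T(1)] show ?thesis
      using T by (simp add: card_image)
  qed
  obtain T where T: "T \<subseteq> Z" "independent_mod B T" "frag_rank B + card T = frag_rank Z"
    using exists_independent_mod[OF B(1) Z(1) B(2)] by blast
  have fin: "finite T" using T(2) by (simp add: independent_mod_def)
  have inj: "inj_on ?pi T"
  proof (rule inj_onI, rule ccontr)
    fix s t assume st: "s \<in> T" "t \<in> T" "?pi s = ?pi t" "s \<noteq> t"
    let ?n = "\<lambda>u. if u = s then 1 else if u = t then - 1 else 0 :: int"
    have "(\<Sum>u\<in>T. frag_cmul (?n u) u) = (\<Sum>u\<in>{s, t}. frag_cmul (?n u) u)"
      using st fin by (intro sum.mono_neutral_right) auto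
    also have "\<dots> = s - t" using st(4) by simp
    also have "\<dots> \<in> B" using st T(1) cos(3) by blast
    finally show False using independent_modD[OF T(2) _ st(1), of ?n] by simp
  qed
  have "int_independent (G Mod B) (?pi ` T)" using cos(2) T inj by blast
  moreover have "card (?pi ` T) = frag_rank Z - frag_rank B" using T(3) inj by (simp add: card_image)
  moreover have "finite {card A | A. int_independent (G Mod B) A}"
    by (rule finite_subset[of _ "{..frag_rank Z - frag_rank B}"]) (auto intro: bound)
  ultimately have "abelian_rank (G Mod B) = frag_rank Z - frag_rank B"
    unfolding abelian_rank_def by (intro Max_eqI) (auto intro: bound intro!: exI[of _ "?pi ` T"])
  thus ?thesis using T(3) by (simp add: G_def)
qed

section \<open>Betti numbers of complexes of chains\<close>

lemma simplicial_boundary_add: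
  "simplicial_boundary d (c + c') = simplicial_boundary d c + simplicial_boundary d c'"
  by (simp add: simplicial_boundary_def frag_extend_add)

lemma simplicial_boundary_cmul:
  "simplicial_boundary d (frag_cmul n c) = frag_cmul n (simplicial_boundary d c)"
  by (simp add: simplicial_boundary_def frag_extend_cmul)

lemma simplicial_boundary_diff:
  "simplicial_boundary d (c - c') = simplicial_boundary d c - simplicial_boundary d c'"
  by (simp add: simplicial_boundary_def frag_extend_diff)

lemma simplicial_boundary_sum:
  "simplicial_boundary d (sum f I) = (\<Sum>i\<in>I. simplicial_boundary d (f i))"
  by (induction I rule: infinite_finite_induct)
     (simp_all add: simplicial_boundary_add, simp_all add: simplicial_boundary_def)

lemma simplicial_boundary_of:
  "simplicial_boundary (Suc d) (frag_of \<sigma>) =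
     (\<Sum>v\<in>\<sigma>. frag_cmul ((-1) ^ card {u \<in> \<sigma>. u < v}) (frag_of (\<sigma> - {v})))"
  by (simp add: simplicial_boundary_def)

lemma boundary_sign_antisym:
  fixes \<sigma> :: "'a::order set"
  assumes fin: "finite \<sigma>" and v: "v \<in> \<sigma>" and w: "w \<in> \<sigma>" and vw: "v < w"
  shows "(-1) ^ card {u \<in> \<sigma>. u < w} * (-1) ^ card {u \<in> \<sigma> - {w}. u < v}
    = - ((-1) ^ card {u \<in> \<sigma>. u < v} * (-1) ^ card {u \<in> \<sigma> - {v}. u < w} :: int)"
proof -
  have 1: "{u \<in> \<sigma> - {w}. u < v} = {u \<in> \<sigma>. u < v}"
    using vw by auto
  have "{u \<in> \<sigma>. u < w} = insert v {u \<in> \<sigma> - {v}. u < w}"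
    using v vw by auto
  hence 2: "card {u \<in> \<sigma>. u < w} = Suc (card {u \<in> \<sigma> - {v}. u < w})"
    using fin by simp
  show ?thesis unfolding 1 2 by simp
qed

lemma simplicial_boundary_boundary_of:
  fixes \<sigma> :: "'a::order set"
  assumes fin: "finite \<sigma>" and ch: "Complete_Partial_Order.chain (\<le>) \<sigma>"
  shows "simplicial_boundary d (simplicial_boundary (Suc d) (frag_of \<sigma>)) = 0"
proof (cases d)
  case 0
  thus ?thesis by (simp add: simplicial_boundary_def)
next
  case (Suc e)
  define s :: "'a \<Rightarrow> 'a \<Rightarrow> int" where
    "s v w = (-1) ^ card {u \<in> \<sigma>. u < v} * (-1) ^ card {u \<in> \<sigma> - {v}. u < w}" for v w
  define g where "g v w = (if v = w then 0 else frag_cmul (s v w) (frag_of (\<sigma> - {v} - {w})))" for v w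
  have "g w v = - g v w" if "v \<in> \<sigma>" "w \<in> \<sigma>" for v w
  proof (cases "v = w")
    case False
    hence "v < w \<or> w < v"
      using that ch by (auto simp: chain_def less_le)
    hence "s w v = - s v w"
      unfolding s_def using boundary_sign_antisym[OF fin] that by fastforce
    moreover have "\<sigma> - {v} - {w} = \<sigma> - {w} - {v}" by blast
    ultimately show ?thesis using False by (simp add: g_def)
  qed (simp add: g_def)
  hence "(\<Sum>v\<in>\<sigma>. \<Sum>w\<in>\<sigma>. g w v) = (\<Sum>v\<in>\<sigma>. \<Sum>w\<in>\<sigma>. - g v w)"
    by (intro sum.cong refl)
  also have "\<dots> = - (\<Sum>v\<in>\<sigma>. \<Sum>w\<in>\<sigma>. g v w)"
    by (simp only: sum_negf)
  finally have "(\<Sum>v\<in>\<sigma>. \<Sum>w\<in>\<sigma>. g w v) = - (\<Sum>v\<in>\<sigma>. \<Sum>w\<in>\<sigma>. g v w)" .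
  moreover have "(\<Sum>v\<in>\<sigma>. \<Sum>w\<in>\<sigma>. g w v) = (\<Sum>v\<in>\<sigma>. \<Sum>w\<in>\<sigma>. g v w)"
    by (rule sum.swap)
  ultimately have "(\<Sum>v\<in>\<sigma>. \<Sum>w\<in>\<sigma>. g v w) + (\<Sum>v\<in>\<sigma>. \<Sum>w\<in>\<sigma>. g v w) = 0"
    by (metis eq_neg_iff_add_eq_0)
  hence "frag_cmul 2 (\<Sum>v\<in>\<sigma>. \<Sum>w\<in>\<sigma>. g v w) = 0"
    using frag_cmul_distrib[of 1 1 "\<Sum>v\<in>\<sigma>. \<Sum>w\<in>\<sigma>. g v w"] by simp
  hence zero: "(\<Sum>v\<in>\<sigma>. \<Sum>w\<in>\<sigma>. g v w) = 0" by simp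
  have "simplicial_boundary d (simplicial_boundary (Suc d) (frag_of \<sigma>)) =
     (\<Sum>v\<in>\<sigma>. \<Sum>w\<in>\<sigma> - {v}. frag_cmul (s v w) (frag_of (\<sigma> - {v} - {w})))"
    by (simp add: Suc simplicial_boundary_of simplicial_boundary_sum simplicial_boundary_cmul
      frag_cmul_sum s_def)
  also have "\<dots> = (\<Sum>v\<in>\<sigma>. \<Sum>w\<in>\<sigma>. g v w)"
  proof (rule sum.cong[OF refl])
    fix v assume "v \<in> \<sigma>"
    have "(\<Sum>w\<in>\<sigma> - {v}. frag_cmul (s v w) (frag_of (\<sigma> - {v} - {w}))) = (\<Sum>w\<in>\<sigma> - {v}. g v w)"
      by (intro sum.cong) (auto simp: g_def)
    also have "\<dots> = (\<Sum>w\<in>\<sigma>. g v w)"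
      using fin by (intro sum.mono_neutral_left) (auto simp: g_def)
    finally show "(\<Sum>w\<in>\<sigma> - {v}. frag_cmul (s v w) (frag_of (\<sigma> - {v} - {w}))) = (\<Sum>w\<in>\<sigma>. g v w)" .
  qed
  finally show ?thesis using zero by simp
qed

definition chain_complex :: "'a::order set set \<Rightarrow> bool" where
  "chain_complex K \<longleftrightarrow>
     (\<forall>\<sigma>\<in>K. Complete_Partial_Order.chain (\<le>) \<sigma> \<and> (\<forall>\<tau>. \<tau> \<subseteq> \<sigma> \<longrightarrow> \<tau> \<in> K))"

lemma chain_complexD:
  "chain_complex K \<Longrightarrow> \<sigma> \<in> K \<Longrightarrow> Complete_Partial_Order.chain (\<le>) \<sigma>"
  "chain_complex K \<Longrightarrow> \<sigma> \<in> K \<Longrightarrow> \<tau> \<subseteq> \<sigma> \<Longrightarrow> \<tau> \<in> K"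
  by (auto simp: chain_complex_def)

lemma keys_simplicial_boundary_of:
  assumes "finite \<sigma>" "card \<sigma> = Suc d + 1" "\<And>v. v \<in> \<sigma> \<Longrightarrow> \<sigma> - {v} \<in> K"
  shows "Poly_Mapping.keys (simplicial_boundary (Suc d) (frag_of \<sigma>)) \<subseteq> simplices d K"
proof -
  have "\<sigma> - {v} \<in> simplices d K" if "v \<in> \<sigma>" for v
    using assms that by (simp add: simplices_def)
  hence "(\<Sum>v\<in>\<sigma>. frag_cmul ((-1) ^ card {u \<in> \<sigma>. u < v}) (frag_of (\<sigma> - {v})))
      \<in> carrier (free_Abelian_group (simplices d K))"
    by (intro sum_closed_free_Abelian_group) (auto dest!: subsetD[OF keys_cmul])
  thus ?thesis by (simp add: simplicial_boundary_of)
qed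

lemma simplicial_boundary_closed:
  fixes K :: "'a::order set set"
  assumes K: "chain_complex K" and c: "c \<in> carrier (free_Abelian_group (simplices (Suc d) K))"
  shows "simplicial_boundary (Suc d) c \<in> carrier (free_Abelian_group (simplices d K))"
    and "simplicial_boundary d (simplicial_boundary (Suc d) c) = 0"
proof -
  have *: "Poly_Mapping.keys c \<subseteq> simplices (Suc d) K" using c by simp
  have "simplicial_boundary (Suc d) c \<in> carrier (free_Abelian_group (simplices d K)) \<and>
     simplicial_boundary d (simplicial_boundary (Suc d) c) = 0"
    using *
  proof (induction c rule: frag_induction)
    case zero
    show ?case by (simp add: simplicial_boundary_def)
  next
    case (one \<sigma>)
    hence \<sigma>: "finite \<sigma>" "card \<sigma> = Suc d + 1" "\<sigma> \<in> K" by (auto simp: simplices_def)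
    show ?case
      using keys_simplicial_boundary_of[OF \<sigma>(1,2), of K] chain_complexD(2)[OF K \<sigma>(3)]
        simplicial_boundary_boundary_of[OF \<sigma>(1) chain_complexD(1)[OF K \<sigma>(3)]]
      by auto
  next
    case (diff a b)
    thus ?case
      by (auto simp: simplicial_boundary_diff dest!: subsetD[OF keys_diff])
  qed
  thus "simplicial_boundary (Suc d) c \<in> carrier (free_Abelian_group (simplices d K))"
    "simplicial_boundary d (simplicial_boundary (Suc d) c) = 0" by auto
qed

lemma span_frag_vec_image:
  fixes f :: "('b \<Rightarrow>\<^sub>0 int) \<Rightarrow> ('c::finite \<Rightarrow>\<^sub>0 int)"
  assumes diff: "\<And>x y. f (x - y) = f x - f y"
  shows "vec.span (frag_vec ` f ` carrier (free_Abelian_group S)) =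
         vec.span ((\<lambda>s. frag_vec (f (frag_of s))) ` S)"
proof (rule vec.span_eq[THEN iffD2], intro conjI subsetI)
  fix x assume "x \<in> frag_vec ` f ` carrier (free_Abelian_group S)"
  then obtain c where c: "Poly_Mapping.keys c \<subseteq> S" "x = frag_vec (f c)" by auto
  have f0: "f 0 = 0" using diff[of 0 0] by simp
  have "frag_vec (f c) \<in> vec.span ((\<lambda>s. frag_vec (f (frag_of s))) ` S)"
    using c(1)
    by (induction c rule: frag_induction)
       (auto simp: f0 diff frag_vec_diff vec.span_zero vec.span_base vec.span_diff)
  thus "x \<in> vec.span ((\<lambda>s. frag_vec (f (frag_of s))) ` S)" by (simp add: c(2))
next
  fix x assume "x \<in> (\<lambda>s. frag_vec (f (frag_of s))) ` S"
  then obtain s where s: "s \<in> S" "x = frag_vec (f (frag_of s))" by blast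
  show "x \<in> vec.span (frag_vec ` f ` carrier (free_Abelian_group S))"
    unfolding s(2) by (intro vec.span_base imageI) (simp add: s(1))
qed

lemma frag_rank_free_Abelian_group:
  "frag_rank (carrier (free_Abelian_group (S :: 'b::finite set))) = card S"
proof -
  have "vec.dim (frag_vec ` (\<lambda>c. c) ` carrier (free_Abelian_group S)) =
        vec.dim ((\<lambda>s. axis s 1 :: rat ^ 'b) ` S)"
    by (subst vec.span_eq_dim[OF span_frag_vec_image]) (simp_all add: frag_vec_of)
  also have "\<dots> = card ((\<lambda>s. axis s 1 :: rat ^ 'b) ` S)"
    by (intro vec.dim_eq_card_independent vec.independent_mono[OF vec.independent_Basis])
       (auto simp: cart_basis_def)
  also have "\<dots> = card S"
    by (intro card_image inj_onI) (simp add: axis_eq_axis)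
  finally show ?thesis by (simp add: frag_rank_def)
qed

definition boundary_rank :: "nat \<Rightarrow> ('a::{finite, order}) set set \<Rightarrow> nat" where
  "boundary_rank d K =
     vec.dim ((\<lambda>\<sigma>. frag_vec (simplicial_boundary d (frag_of \<sigma>))) ` simplices d K)"

lemma frag_rank_boundaries:
  "frag_rank (simplicial_boundary d ` carrier (free_Abelian_group (simplices d K))) = boundary_rank d K"
  unfolding frag_rank_def boundary_rank_def
  by (intro vec.span_eq_dim span_frag_vec_image simplicial_boundary_diff)

lemma betti_number_boundary_rank:
  fixes K :: "'a::{finite, order} set set"
  assumes K: "chain_complex K"
  shows "betti_number d K + boundary_rank d K + boundary_rank (Suc d) K = card (simplices d K)"
proof -
  let ?C = "\<lambda>d. carrier (free_Abelian_group (simplices d K))"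
  let ?Z = "simplicial_cycles d K" and ?B = "simplicial_boundaries d K"
  have Z: "?Z = {c \<in> ?C d. simplicial_boundary d c = 0}"
    by (simp add: simplicial_cycles_def simplicial_chain_group_def)
  have B: "?B = simplicial_boundary (Suc d) ` ?C (Suc d)"
    by (simp add: simplicial_boundaries_def simplicial_chain_group_def)
  have subZ: "frag_submodule ?Z"
    using frag_submodule_free[of "simplices d K"] unfolding Z frag_submodule_def
    by (auto simp: simplicial_boundary_add simplicial_boundary_cmul) (simp add: simplicial_boundary_def)
  have subB: "frag_submodule ?B"
    using frag_submodule_image[OF frag_submodule_free simplicial_boundary_add simplicial_boundary_cmul]
    unfolding B .
  have "?B \<subseteq> ?Z"
    using simplicial_boundary_closed[OF K] unfolding B Z by blast
  moreover have "?Z \<subseteq> ?C d" unfolding Z by blast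
  ultimately have "betti_number d K + frag_rank ?B = frag_rank ?Z"
    unfolding betti_number_def simplicial_homology_group_def simplicial_chain_group_def
    using abelian_rank_quotient subZ subB by blast
  moreover have "frag_rank ?Z + boundary_rank d K = card (simplices d K)"
    using rank_nullity[OF frag_submodule_free[of "simplices d K"] simplicial_boundary_add[of d]
      simplicial_boundary_cmul[of d]]
    by (simp add: Z frag_rank_boundaries frag_rank_free_Abelian_group)
  moreover have "frag_rank ?B = boundary_rank (Suc d) K"
    unfolding B by (rule frag_rank_boundaries)
  ultimately show ?thesis by simp
qed

section \<open>Attaching cells\<close>

lemma simplices_insert:
  "simplices d (insert (\<tau> :: 'a::finite set) K) =
     (if card \<tau> = Suc d then insert \<tau> (simplices d K) else simplices d K)"
  by (auto simp: simplices_def)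

lemma boundary_rank_0 [simp]: "boundary_rank 0 K = 0"
proof -
  have "(\<lambda>\<sigma>. frag_vec (simplicial_boundary 0 (frag_of \<sigma>))) ` simplices 0 K \<subseteq> vec.span {}"
    by (auto simp: simplicial_boundary_def)
  from vec.dim_mono[OF this] show ?thesis by (simp add: boundary_rank_def)
qed

lemma boundary_rank_insert:
  "boundary_rank d (insert \<tau> K) = boundary_rank d K +
     (if card \<tau> = Suc d \<and> frag_vec (simplicial_boundary d (frag_of \<tau>)) \<notin>
        vec.span ((\<lambda>\<sigma>. frag_vec (simplicial_boundary d (frag_of \<sigma>))) ` simplices d K)
      then 1 else 0)"
  by (simp add: boundary_rank_def simplices_insert vec.dim_insert)

definition betti_step :: "'a::{finite, order} set set \<Rightarrow> 'a set set \<Rightarrow> bool" where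
  "betti_step K K' \<longleftrightarrow>
     (\<exists>e. (\<forall>d. d \<noteq> e \<longrightarrow> betti_number d K' = betti_number d K) \<and>
          \<bar>int (betti_number e K') - int (betti_number e K)\<bar> \<le> 1)"

lemma betti_step_insert:
  fixes K :: "'a::{finite, order} set set"
  assumes K: "chain_complex K" and K': "chain_complex (insert \<tau> K)" and \<tau>: "\<tau> \<notin> K" "\<tau> \<noteq> {}"
  shows "betti_step K (insert \<tau> K)"
proof -
  obtain e where e: "card \<tau> = Suc e"
    using \<tau>(2) by (metis card_eq_0_iff finite not0_implies_Suc)
  have card: "card (simplices d (insert \<tau> K)) = card (simplices d K) + (if d = e then 1 else 0)" for d
    using \<tau>(1) e by (auto simp: simplices_insert card_insert_if) (auto simp: simplices_def)
  note b = betti_number_boundary_rank[OF K] betti_number_boundary_rank[OF K']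
  have rank: "boundary_rank d (insert \<tau> K) = boundary_rank d K" if "d \<noteq> e" for d
    using that e by (simp add: boundary_rank_insert)
  consider "boundary_rank e (insert \<tau> K) = boundary_rank e K"
    | f where "e = Suc f" "boundary_rank e (insert \<tau> K) = boundary_rank e K + 1"
  proof (cases e)
    case 0
    thus ?thesis using that(1) by simp
  next
    case (Suc f)
    have "boundary_rank e (insert \<tau> K) = boundary_rank e K \<or>
        boundary_rank e (insert \<tau> K) = boundary_rank e K + 1"
      by (simp add: boundary_rank_insert)
    thus ?thesis using that Suc by blast
  qed
  thus ?thesis
  proof cases
    case 1
    hence "boundary_rank d (insert \<tau> K) = boundary_rank d K" for d
      using rank by (cases "d = e") auto
    hence "betti_number d (insert \<tau> K) = betti_number d K + (if d = e then 1 else 0)" for d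
      using b[of d] card[of d] by simp
    thus ?thesis unfolding betti_step_def by (intro exI[of _ e]) simp
  next
    case 2
    have "betti_number d (insert \<tau> K) + (if d = f then 1 else 0) = betti_number d K" for d
    proof (cases "d = e \<or> d = f")
      case True
      thus ?thesis using b[of d] card[of d] rank[of d] rank[of "Suc d"] 2 by auto
    next
      case False
      hence "Suc d \<noteq> e" using 2(1) by simp
      thus ?thesis using False b[of d] card[of d] rank[of d] rank[of "Suc d"] by simp
    qed
    hence *: "betti_number d K = betti_number d (insert \<tau> K) + (if d = f then 1 else 0)" for d
      by simp
    show ?thesis unfolding betti_step_def by (intro exI[of _ f]) (simp add: *)
  qed
qed

text \<open>An elementary expansion: the new cell \<open>\<tau>\<close> kills exactly the class that \<open>\<sigma>\<close> would create.\<close>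

lemma betti_number_insert_pair:
  fixes K :: "'a::{finite, order} set set"
  assumes K: "chain_complex K" and K': "chain_complex (insert (insert y \<sigma>) (insert \<sigma> K))"
    and new: "\<sigma> \<notin> K" "insert y \<sigma> \<notin> K" and y: "y \<notin> \<sigma>" and ne: "\<sigma> \<noteq> {}"
    and faces: "\<And>v. v \<in> \<sigma> \<Longrightarrow> insert y \<sigma> - {v} \<in> K"
  shows "betti_number d (insert (insert y \<sigma>) (insert \<sigma> K)) = betti_number d K"
proof -
  let ?\<tau> = "insert y \<sigma>"
  let ?bd = "\<lambda>d \<sigma>. frag_vec (simplicial_boundary d (frag_of \<sigma>)) :: rat ^ 'a set"
  obtain e where e: "card \<sigma> = Suc e"
    using ne by (metis card_eq_0_iff finite not0_implies_Suc)
  have card_\<tau>: "card ?\<tau> = Suc (Suc e)" using y e by simp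
  have \<tau>_chain: "Complete_Partial_Order.chain (\<le>) ?\<tau>" using chain_complexD(1)[OF K'] by blast
  define c where "c = (\<Sum>v\<in>\<sigma>. frag_cmul ((-1) ^ card {u \<in> ?\<tau>. u < v}) (frag_of (?\<tau> - {v})))"
  define s :: int where "s = (-1) ^ card {u \<in> ?\<tau>. u < y}"
  have s: "s * s = 1" unfolding s_def by (simp flip: power_mult_distrib)
  have bd_\<tau>: "simplicial_boundary (Suc e) (frag_of ?\<tau>) = frag_cmul s (frag_of \<sigma>) + c"
    using y by (simp add: simplicial_boundary_of c_def s_def)
  have "frag_of (?\<tau> - {v}) \<in> carrier (free_Abelian_group (simplices e K))" if "v \<in> \<sigma>" for v
    using faces[OF that] that y e card_\<tau> by (simp add: simplices_def)
  hence c: "c \<in> carrier (free_Abelian_group (simplices e K))"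
    unfolding c_def
    by (intro frag_submodule_sum[OF frag_submodule_free] frag_submodule_cmul[OF frag_submodule_free])
  have bd_\<sigma>: "?bd e \<sigma> \<in> vec.span (?bd e ` simplices e K)"
  proof -
    have "simplicial_boundary e (frag_cmul s (frag_of \<sigma>) + c) = 0"
      using simplicial_boundary_boundary_of[OF _ \<tau>_chain, of e] by (simp only: bd_\<tau> finite)
    hence "frag_cmul s (simplicial_boundary e (frag_of \<sigma>)) = - simplicial_boundary e c"
      by (simp add: simplicial_boundary_add simplicial_boundary_cmul flip: eq_neg_iff_add_eq_0)
    hence "frag_cmul s (frag_cmul s (simplicial_boundary e (frag_of \<sigma>)))
        = frag_cmul s (frag_cmul (- 1) (simplicial_boundary e c))"
      by simp
    hence "frag_cmul (s * s) (simplicial_boundary e (frag_of \<sigma>)) = simplicial_boundary e (frag_cmul (- s) c)"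
      by (simp only: simplicial_boundary_cmul frag_cmul_cmul) simp
    hence "simplicial_boundary e (frag_of \<sigma>) = simplicial_boundary e (frag_cmul (- s) c)"
      by (simp add: s)
    hence "?bd e \<sigma> \<in> frag_vec ` simplicial_boundary e ` carrier (free_Abelian_group (simplices e K))"
      using frag_submodule_cmul[OF frag_submodule_free c, of "- s"] by auto
    hence "?bd e \<sigma> \<in> vec.span (frag_vec ` simplicial_boundary e ` carrier (free_Abelian_group (simplices e K)))"
      by (rule vec.span_base)
    thus ?thesis by (subst (asm) span_frag_vec_image) (rule simplicial_boundary_diff)
  qed
  have bd_\<tau>': "?bd (Suc e) ?\<tau> \<notin> vec.span (?bd (Suc e) ` simplices (Suc e) (insert \<sigma> K))"
  proof
    assume *: "?bd (Suc e) ?\<tau> \<in> vec.span (?bd (Suc e) ` simplices (Suc e) (insert \<sigma> K))"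
    have "x $ \<sigma> = 0" if "x \<in> vec.span (?bd (Suc e) ` simplices (Suc e) (insert \<sigma> K))" for x
      using that
    proof (induction rule: vec.span_induct_alt)
      case (step q x z)
      from step.hyps obtain \<rho> where \<rho>: "\<rho> \<in> simplices (Suc e) (insert \<sigma> K)" "x = ?bd (Suc e) \<rho>"
        by blast
      have "\<rho> \<in> K" "finite \<rho>" "card \<rho> = Suc e + 1" using \<rho>(1) e by (auto simp: simplices_def)
      with keys_simplicial_boundary_of[of \<rho> e K] chain_complexD(2)[OF K]
      have "Poly_Mapping.keys (simplicial_boundary (Suc e) (frag_of \<rho>)) \<subseteq> K"
        by (auto simp: simplices_def)
      hence "\<sigma> \<notin> Poly_Mapping.keys (simplicial_boundary (Suc e) (frag_of \<rho>))"
        using new(1) by blast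
      hence "x $ \<sigma> = 0" by (simp add: \<rho>(2) frag_vec_def in_keys_iff)
      thus ?case using step.IH by simp
    qed simp
    from this[OF *] have "Poly_Mapping.lookup (frag_cmul s (frag_of \<sigma>) + c) \<sigma> = 0"
      by (simp add: bd_\<tau> frag_vec_def)
    moreover have "Poly_Mapping.lookup c \<sigma> = 0"
      using c new(1) by (auto simp: simplices_def in_keys_iff)
    ultimately show False using s by (simp add: lookup_add)
  qed
  have rank: "boundary_rank d (insert ?\<tau> (insert \<sigma> K)) = boundary_rank d K + (if d = Suc e then 1 else 0)" for d
    using bd_\<sigma> bd_\<tau>' e card_\<tau> by (auto simp: boundary_rank_insert simplices_insert)
  have "?\<tau> \<noteq> \<sigma>" using y by blast
  hence card: "card (simplices d (insert ?\<tau> (insert \<sigma> K))) =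
     card (simplices d K) + (if d = e \<or> d = Suc e then 1 else 0)" for d
    using new e card_\<tau>
    by (auto simp: simplices_insert card_insert_if) (auto simp: simplices_def)
  show ?thesis
    using betti_number_boundary_rank[OF K, of d] betti_number_boundary_rank[OF K', of d]
      card[of d] rank[of d] rank[of "Suc d"] by (auto split: if_splits)
qed

lemma chain_complex_insert:
  assumes "chain_complex K" "Complete_Partial_Order.chain (\<le>) \<sigma>" "\<And>\<tau>. \<tau> \<subset> \<sigma> \<Longrightarrow> \<tau> \<in> K"
  shows "chain_complex (insert \<sigma> K)"
  using assms unfolding chain_complex_def by (auto simp: subset_iff_psubset_eq)

lemma betti_number_toggle:
  fixes K K' :: "'a::{finite, order} set set"
  assumes "chain_complex K" "chain_complex K'" "K \<subseteq> K'" "{} \<in> K"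
    and "\<And>\<sigma>. \<sigma> \<in> K' - K \<Longrightarrow> insert y \<sigma> \<in> K' - K \<and> \<sigma> - {y} \<in> K' - K"
  shows "betti_number d K' = betti_number d K"
  using assms
proof (induction "card (K' - K)" arbitrary: K rule: less_induct)
  case less
  note K = less.prems(1) and K' = less.prems(2) and toggle = less.prems(5)
  show ?case
  proof (cases "K' = K")
    case False
    hence "K' - K \<noteq> {}" using less.prems(3) by blast
    then obtain \<sigma> where \<sigma>: "\<sigma> \<in> K' - K" and min: "\<And>\<rho>. \<rho> \<in> K' - K \<Longrightarrow> card \<sigma> \<le> card \<rho>"
      using arg_min_if_finite[of "K' - K" card] by (metis finite arg_min_least)
    have below: "\<rho> \<in> K" if "\<rho> \<subset> \<sigma>" for \<rho>
    proof (rule ccontr)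
      assume "\<rho> \<notin> K"
      hence "\<rho> \<in> K' - K" using that \<sigma> chain_complexD(2)[OF K', of \<sigma> \<rho>] by auto
      from min[OF this] psubset_card_mono[OF finite that] show False by simp
    qed
    have y: "y \<notin> \<sigma>"
    proof
      assume "y \<in> \<sigma>"
      hence "\<sigma> - {y} \<in> K" by (intro below) auto
      thus False using toggle[OF \<sigma>] by blast
    qed
    define L where "L = insert (insert y \<sigma>) (insert \<sigma> K)"
    have \<tau>: "insert y \<sigma> \<in> K' - K" using toggle[OF \<sigma>] by blast
    have below': "\<rho> \<in> insert \<sigma> K" if \<rho>: "\<rho> \<subset> insert y \<sigma>" for \<rho>
    proof (cases "y \<in> \<rho>")
      case True
      have "\<rho> - {y} \<subset> \<sigma>" using \<rho> True y by blast
      hence "\<rho> - {y} \<in> K" by (rule below)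
      moreover have "\<rho> \<in> K'" using \<rho> \<tau> chain_complexD(2)[OF K', of "insert y \<sigma>" \<rho>] by auto
      ultimately show ?thesis using toggle[of \<rho>] by blast
    next
      case False
      hence "\<rho> \<subseteq> \<sigma>" using \<rho> by blast
      thus ?thesis using below by blast
    qed
    have "chain_complex (insert \<sigma> K)"
      using \<sigma> chain_complexD(1)[OF K'] below by (intro chain_complex_insert[OF K]) auto
    hence L: "chain_complex L"
      unfolding L_def by (rule chain_complex_insert) (use \<tau> chain_complexD(1)[OF K'] below' in auto)
    have "betti_number d L = betti_number d K"
      unfolding L_def
    proof (rule betti_number_insert_pair[OF K L[unfolded L_def]])
      show "\<sigma> \<noteq> {}" using \<sigma> less.prems(4) by blast
      fix v assume v: "v \<in> \<sigma>"
      hence "insert y \<sigma> - {v} \<noteq> \<sigma>" by blast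
      moreover have "insert y \<sigma> - {v} \<in> insert \<sigma> K" using v by (intro below') auto
      ultimately show "insert y \<sigma> - {v} \<in> K" by blast
    qed (use \<sigma> \<tau> y in auto)
    moreover have "betti_number d K' = betti_number d L"
    proof (rule less.hyps[OF _ L K'])
      have "K' - L \<subset> K' - K" using \<sigma> unfolding L_def by blast
      thus "card (K' - L) < card (K' - K)" by (intro psubset_card_mono) auto
      show "L \<subseteq> K'" using \<sigma> \<tau> less.prems(3) unfolding L_def by blast
      show "{} \<in> L" using less.prems(4) unfolding L_def by blast
    next
      fix \<rho> assume \<rho>: "\<rho> \<in> K' - L"
      hence \<rho>': "\<rho> \<in> K' - K" "\<rho> \<noteq> \<sigma>" "\<rho> \<noteq> insert y \<sigma>" unfolding L_def by auto
      have "insert y \<rho> \<noteq> \<sigma>" "\<rho> - {y} \<noteq> insert y \<sigma>" using y by auto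
      moreover have "insert y \<rho> \<noteq> insert y \<sigma>" "\<rho> - {y} \<noteq> \<sigma>" using \<rho>' y by auto
      ultimately show "insert y \<rho> \<in> K' - L \<and> \<rho> - {y} \<in> K' - L"
        using toggle[OF \<rho>'(1)] unfolding L_def by blast
    qed
    ultimately show ?thesis by simp
  qed simp
qed

lemma betti_step_eq: "(\<And>d. betti_number d K' = betti_number d K) \<Longrightarrow> betti_step K K'"
  unfolding betti_step_def by simp

lemma chain_insert:
  "Complete_Partial_Order.chain (\<le>) (insert x C) \<longleftrightarrow>
     Complete_Partial_Order.chain (\<le>) C \<and> (\<forall>y\<in>C. x \<le> y \<or> y \<le> (x :: 'a::order))"
  by (auto simp: chain_def)

lemma finite_chain_least:
  fixes C :: "'a::order set"
  assumes "finite C" "C \<noteq> {}" "Complete_Partial_Order.chain (\<le>) C"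
  obtains m where "m \<in> C" "\<And>x. x \<in> C \<Longrightarrow> m \<le> x"
proof -
  obtain m where m: "m \<in> C" "\<And>x. x \<in> C \<Longrightarrow> x \<le> m \<Longrightarrow> m = x"
    using finite_has_minimal[OF assms(1,2)] by blast
  have "m \<le> x" if "x \<in> C" for x
    using chainD[OF assms(3) m(1) that] m(2)[OF that] by auto
  thus thesis using that m(1) by blast
qed

lemma finite_chain_greatest:
  fixes C :: "'a::order set"
  assumes "finite C" "C \<noteq> {}" "Complete_Partial_Order.chain (\<le>) C"
  obtains m where "m \<in> C" "\<And>x. x \<in> C \<Longrightarrow> x \<le> m"
proof -
  obtain m where m: "m \<in> C" "\<And>x. x \<in> C \<Longrightarrow> m \<le> x \<Longrightarrow> m = x"
    using finite_has_maximal[OF assms(1,2)] by blast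
  have "x \<le> m" if "x \<in> C" for x
    using chainD[OF assms(3) m(1) that] m(2)[OF that] by auto
  thus thesis using that m(1) by blast
qed

definition interval_in :: "'a::order set \<Rightarrow> 'a set \<Rightarrow> bool" where
  "interval_in B J \<longleftrightarrow> J \<subseteq> B \<and> (\<forall>x\<in>J. \<forall>z\<in>J. \<forall>y\<in>B. x \<le> y \<longrightarrow> y \<le> z \<longrightarrow> y \<in> J)"

definition hitting_sets :: "'a set \<Rightarrow> 'a set set \<Rightarrow> 'a set set" where
  "hitting_sets B \<I> = {\<sigma>. \<sigma> \<subseteq> B \<and> (\<forall>J\<in>\<I>. \<sigma> \<inter> J \<noteq> {})}"

lemma betti_step_hitting_sets:
  fixes K K' :: "'a::{finite, order} set set"
  assumes "chain_complex K" "chain_complex K'" "K \<subseteq> K'" "{} \<in> K"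
    and "A \<inter> B = {}" "Complete_Partial_Order.chain (\<le>) B"
    and "\<And>J. J \<in> \<I> \<Longrightarrow> interval_in B J"
    and "K' - K = (\<union>) A ` hitting_sets B \<I>"
  shows "betti_step K K'"
  using assms
proof (induction "card B" arbitrary: A B \<I> K K' rule: less_induct)
  case less
  note K = less.prems(1) and K' = less.prems(2) and sub = less.prems(3) and empty = less.prems(4)
    and AB = less.prems(5) and B = less.prems(6) and int = less.prems(7) and new = less.prems(8)
  consider "\<I> = {}" "B = {}" | y where "\<I> = {}" "y \<in> B" | "{} \<in> \<I>" | "\<I> \<noteq> {}" "{} \<notin> \<I>"
    by blast
  thus ?case
  proof cases
    case 1
    hence "hitting_sets B \<I> = {{}}" by (auto simp: hitting_sets_def)
    hence KA: "K' - K = {A}" using new by simp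
    hence "K' = insert A K" using sub by blast
    moreover have "A \<notin> K" "A \<noteq> {}" using KA empty by auto
    ultimately show ?thesis using betti_step_insert K K' by blast
  next
    case 2
    have *: "K' - K = (\<union>) A ` Pow B" using new 2(1) by (simp add: hitting_sets_def Pow_def)
    show ?thesis
    proof (rule betti_step_eq, rule betti_number_toggle[OF K K' sub empty])
      fix \<sigma> assume "\<sigma> \<in> K' - K"
      then obtain \<rho> where \<rho>: "\<rho> \<subseteq> B" "\<sigma> = A \<union> \<rho>" using * by auto
      have "insert y \<sigma> = A \<union> insert y \<rho>" "\<sigma> - {y} = A \<union> (\<rho> - {y})"
        using \<rho>(2) 2(2) AB by auto
      moreover have "insert y \<rho> \<in> Pow B" "\<rho> - {y} \<in> Pow B" using \<rho>(1) 2(2) by auto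
      ultimately show "insert y \<sigma> \<in> K' - K \<and> \<sigma> - {y} \<in> K' - K" unfolding * by blast
    qed
  next
    case 3
    hence "hitting_sets B \<I> = {}" by (auto simp: hitting_sets_def)
    hence "K' = K" using new sub by auto
    thus ?thesis by (simp add: betti_step_eq)
  next
    case 4
    have greatest: "\<exists>m\<in>J. \<forall>x\<in>J. x \<le> m" if "J \<in> \<I>" for J
    proof -
      have "J \<noteq> {}" "J \<subseteq> B" using that 4 int[OF that] by (auto simp: interval_in_def)
      moreover have "Complete_Partial_Order.chain (\<le>) J" using chain_subset[OF B] \<open>J \<subseteq> B\<close> by blast
      ultimately show ?thesis using finite_chain_greatest[of J] by (metis finite)
    qed
    define M where "M = {m. \<exists>J\<in>\<I>. m \<in> J \<and> (\<forall>x\<in>J. x \<le> m)}"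
    have "M \<subseteq> B" using int unfolding M_def interval_in_def by blast
    hence "Complete_Partial_Order.chain (\<le>) M" using chain_subset[OF B] by blast
    moreover have "M \<noteq> {}" using 4(1) greatest unfolding M_def by blast
    ultimately obtain b where b: "b \<in> M" "\<And>m. m \<in> M \<Longrightarrow> b \<le> m"
      using finite_chain_least[of M] by (metis finite)
    obtain J0 where J0: "J0 \<in> \<I>" "b \<in> J0" "\<And>x. x \<in> J0 \<Longrightarrow> x \<le> b"
      using b(1) unfolding M_def by blast
    have bB: "b \<in> B" using b(1) \<open>M \<subseteq> B\<close> by blast
    have card: "card (B - {b}) < card B" using bB by (intro psubset_card_mono) auto
    have disj: "A \<inter> (B - {b}) = {}" using AB by blast
    have chain: "Complete_Partial_Order.chain (\<le>) (B - {b})"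
      using chain_subset[OF B] by blast
    \<comment> \<open>Since \<open>b\<close> is the least right end point, it lies in every interval that contains an element
      to the left of \<open>b\<close>.\<close>
    have dominate: "b \<in> J" if J: "J \<in> \<I>" and y: "y \<in> J" "y \<le> b" for J y
    proof -
      obtain m where m: "m \<in> J" "\<forall>x\<in>J. x \<le> m" using greatest[OF J] by blast
      hence "b \<le> m" using b(2) J unfolding M_def by blast
      thus ?thesis using int[OF J] y m(1) bB unfolding interval_in_def by blast
    qed
    show ?thesis
    proof (cases "\<exists>y\<in>B. y < b")
      case True
      then obtain y where y: "y \<in> B" "y < b" by blast
      define \<J> where "\<J> = (\<lambda>J. J - {b}) ` \<I>"
      define L where "L = K \<union> (\<union>) A ` hitting_sets (B - {b}) \<J>"
      have hit: "hitting_sets (B - {b}) \<J> = {\<sigma> \<in> hitting_sets B \<I>. b \<notin> \<sigma>}"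
        unfolding hitting_sets_def \<J>_def by auto
      have bA: "b \<notin> A" using bB AB by blast
      have new_L: "L - K = (\<union>) A ` hitting_sets (B - {b}) \<J>"
        unfolding L_def hit using new by blast
      have LK': "L \<subseteq> K'"
        unfolding L_def hit using new sub by blast
      have L: "chain_complex L"
        unfolding chain_complex_def
      proof (intro ballI conjI allI impI)
        fix \<sigma> assume \<sigma>: "\<sigma> \<in> L"
        thus "Complete_Partial_Order.chain (\<le>) \<sigma>" using chain_complexD(1)[OF K'] LK' by blast
        fix \<tau> assume \<tau>: "\<tau> \<subseteq> \<sigma>"
        show "\<tau> \<in> L"
        proof (cases "\<sigma> \<in> K \<or> \<tau> \<in> K")
          case True
          thus ?thesis using chain_complexD(2)[OF K _ \<tau>] unfolding L_def by blast
        next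
          case False
          hence "\<sigma> \<in> L - K" using \<sigma> by blast
          hence "b \<notin> \<sigma>" unfolding new_L hit using bA by auto
          hence b\<tau>: "b \<notin> \<tau>" using \<tau> by blast
          have "\<tau> \<in> K'" using chain_complexD(2)[OF K' _ \<tau>] \<sigma> LK' by blast
          hence "\<tau> \<in> K' - K" using False by blast
          then obtain \<rho> where "\<rho> \<in> hitting_sets B \<I>" "\<tau> = A \<union> \<rho>" using new by auto
          thus ?thesis using b\<tau> unfolding L_def hit by auto
        qed
      qed
      have int': "interval_in (B - {b}) J" if J: "J \<in> \<J>" for J
      proof -
        obtain J' where "J' \<in> \<I>" "J = J' - {b}" using J unfolding \<J>_def by blast
        thus ?thesis using int[of J'] unfolding interval_in_def by auto
      qed
      have "K \<subseteq> L" unfolding L_def by blast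
      hence "betti_step K L"
        by (rule less.hyps[OF card K L _ empty disj chain int' new_L])
      moreover have "betti_number d K' = betti_number d L" for d
      proof (rule betti_number_toggle[OF L K' LK'])
        show "{} \<in> L" using empty unfolding L_def by blast
        fix \<sigma> assume "\<sigma> \<in> K' - L"
        hence \<sigma>: "\<sigma> \<in> K' - K" "\<sigma> \<notin> L" unfolding L_def by auto
        then obtain \<rho> where \<rho>: "\<rho> \<in> hitting_sets B \<I>" "\<sigma> = A \<union> \<rho>" using new by auto
        have b\<rho>: "b \<in> \<rho>" using \<sigma>(2) \<rho> unfolding L_def hit by blast
        have "insert y \<rho> \<in> hitting_sets B \<I>"
          using \<rho>(1) y(1) unfolding hitting_sets_def by blast
        moreover have "\<rho> - {y} \<in> hitting_sets B \<I>"
          unfolding hitting_sets_def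
        proof (intro CollectI conjI ballI)
          show "\<rho> - {y} \<subseteq> B" using \<rho>(1) unfolding hitting_sets_def by blast
          fix J assume J: "J \<in> \<I>"
          then obtain x where x: "x \<in> \<rho>" "x \<in> J" using \<rho>(1) unfolding hitting_sets_def by blast
          show "(\<rho> - {y}) \<inter> J \<noteq> {}"
          proof (cases "x = y")
            case True
            hence "b \<in> J" using dominate[OF J x(2)] y(2) by simp
            thus ?thesis using b\<rho> y(2) by blast
          qed (use x in blast)
        qed
        moreover have "insert y \<sigma> = A \<union> insert y \<rho>" "\<sigma> - {y} = A \<union> (\<rho> - {y})"
          using \<rho>(2) y(1) AB by auto
        ultimately have "insert y \<sigma> \<in> K' - K" "\<sigma> - {y} \<in> K' - K"
          unfolding new by blast+
        moreover have "b \<in> insert y \<sigma>" "b \<in> \<sigma> - {y}" using b\<rho> \<rho>(2) y(2) by auto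
        moreover have "b \<notin> \<tau>" if "\<tau> \<in> L - K" for \<tau>
          using that bA unfolding new_L hit by auto
        ultimately show "insert y \<sigma> \<in> K' - L \<and> \<sigma> - {y} \<in> K' - L" by blast
      qed
      ultimately show ?thesis by (simp add: betti_step_def)
    next
      case False
      define \<J> where "\<J> = {J \<in> \<I>. b \<notin> J}"
      have "x = b" if x: "x \<in> J0" for x
      proof -
        have "x \<in> B" using x int[OF J0(1)] unfolding interval_in_def by blast
        moreover have "x \<le> b" using J0(3)[OF x] .
        ultimately show ?thesis using False by (auto simp: less_le)
      qed
      hence "J0 = {b}" using J0(2) by blast
      hence b\<I>: "{b} \<in> \<I>" using J0(1) by simp
      have "(\<union>) A ` hitting_sets B \<I> = (\<union>) (insert b A) ` hitting_sets (B - {b}) \<J>" (is "?L = ?R")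
      proof (intro equalityI subsetI)
        fix \<sigma> assume "\<sigma> \<in> ?L"
        then obtain \<rho> where \<rho>: "\<rho> \<in> hitting_sets B \<I>" "\<sigma> = A \<union> \<rho>" by blast
        have "b \<in> \<rho>" using \<rho>(1) b\<I> unfolding hitting_sets_def by blast
        hence "\<sigma> = insert b A \<union> (\<rho> - {b})" using \<rho>(2) by blast
        moreover have "\<rho> - {b} \<in> hitting_sets (B - {b}) \<J>"
          using \<rho>(1) unfolding hitting_sets_def \<J>_def by blast
        ultimately show "\<sigma> \<in> ?R" by blast
      next
        fix \<sigma> assume "\<sigma> \<in> ?R"
        then obtain \<rho> where \<rho>: "\<rho> \<in> hitting_sets (B - {b}) \<J>" "\<sigma> = insert b A \<union> \<rho>" by blast
        have "insert b \<rho> \<in> hitting_sets B \<I>"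
          using \<rho>(1) bB unfolding hitting_sets_def \<J>_def by auto
        moreover have "\<sigma> = A \<union> insert b \<rho>" using \<rho>(2) by blast
        ultimately show "\<sigma> \<in> ?L" by blast
      qed
      hence new': "K' - K = (\<union>) (insert b A) ` hitting_sets (B - {b}) \<J>" using new by simp
      have disj': "insert b A \<inter> (B - {b}) = {}" using AB by blast
      have int': "interval_in (B - {b}) J" if J: "J \<in> \<J>" for J
      proof -
        have "interval_in B J" "b \<notin> J" using J int unfolding \<J>_def by blast+
        thus ?thesis unfolding interval_in_def by blast
      qed
      show ?thesis by (rule less.hyps[OF card K K' sub empty disj' chain int' new'])
    qed
  qed
qed

section \<open>Lexicographic orders\<close>

lemma at_rank_card:
  "u \<in> C \<Longrightarrow> u \<in> at_rank C (card {v \<in> C. v \<le> u})"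
  by (simp add: at_rank_def)

lemma rank_strict_mono:
  fixes C :: "'a::{finite, order} set"
  assumes "w \<in> C" "u < w"
  shows "card {v \<in> C. v \<le> u} < card {v \<in> C. v \<le> w}"
proof (rule psubset_card_mono)
  show "{v \<in> C. v \<le> u} \<subset> {v \<in> C. v \<le> w}"
  proof (rule psubsetI)
    show "{v \<in> C. v \<le> u} \<subseteq> {v \<in> C. v \<le> w}"
      using assms(2) by (auto dest: order_trans less_imp_le)
    have "w \<in> {v \<in> C. v \<le> w}" "w \<notin> {v \<in> C. v \<le> u}" using assms by auto
    thus "{v \<in> C. v \<le> u} \<noteq> {v \<in> C. v \<le> w}" by blast
  qed
qed simp

lemma rank_mono:
  fixes C :: "'a::{finite, order} set"
  shows "u \<le> w \<Longrightarrow> card {v \<in> C. v \<le> u} \<le> card {v \<in> C. v \<le> w}"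
  by (intro card_mono) (auto dest: order_trans)

lemma facet_properties:
  assumes "C \<in> facets order_complex"
  shows "Complete_Partial_Order.chain (\<le>) C" "C \<subseteq> UNIV - {bot, Orderings.top}"
    "\<And>x. Complete_Partial_Order.chain (\<le>) (insert x C) \<Longrightarrow> x \<notin> {bot, Orderings.top} \<Longrightarrow> x \<in> C"
proof -
  show *: "Complete_Partial_Order.chain (\<le>) C" "C \<subseteq> UNIV - {bot, Orderings.top}"
    using assms by (auto simp: facets_def order_complex_def)
  fix x assume "Complete_Partial_Order.chain (\<le>) (insert x C)" "x \<notin> {bot, Orderings.top}"
  hence "insert x C \<in> order_complex" using *(2) by (auto simp: order_complex_def)
  hence "C = insert x C" using assms unfolding facets_def by blast
  thus "x \<in> C" by blast
qed

lemma splice_facets: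
  fixes C D :: "'a::{finite, order_bot, order_top} set"
  assumes C: "C \<in> facets order_complex" and D: "D \<in> facets order_complex" and w: "w \<in> C" "w \<in> D"
  shows "{x \<in> C. x < w} \<union> {x \<in> D. w \<le> x} \<in> facets order_complex"
proof -
  let ?E = "{x \<in> C. x < w} \<union> {x \<in> D. w \<le> x}"
  note C' = facet_properties[OF C] and D' = facet_properties[OF D]
  have "Complete_Partial_Order.chain (\<le>) ?E"
  proof (rule chainI)
    fix x y assume "x \<in> ?E" "y \<in> ?E"
    then consider "x \<in> C" "y \<in> C" | "x \<in> D" "y \<in> D" | "x \<le> w" "w \<le> y" | "y \<le> w" "w \<le> x"
      by (auto simp: less_le)
    thus "x \<le> y \<or> y \<le> x"
      using chainD[OF C'(1)] chainD[OF D'(1)] order_trans by cases blast+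
  qed
  hence E: "?E \<in> order_complex" using C'(2) D'(2) by (auto simp: order_complex_def)
  moreover have "?E = G" if G: "G \<in> order_complex" "?E \<subseteq> G" for G
  proof
    show "G \<subseteq> ?E"
    proof
      fix x assume x: "x \<in> G"
      have ch: "Complete_Partial_Order.chain (\<le>) G" and x': "x \<notin> {bot, Orderings.top}"
        using G(1) x by (auto simp: order_complex_def)
      have comp: "x \<le> y \<or> y \<le> x" if "y \<in> ?E" for y
        using chainD[OF ch x] that G(2) by blast
      have "w \<in> ?E" using w by simp
      hence "x < w \<or> w \<le> x" using comp by (auto simp: less_le)
      thus "x \<in> ?E"
      proof
        assume xw: "x < w"
        have "x \<le> y \<or> y \<le> x" if y: "y \<in> C" for y
        proof (cases "y < w")
          case True
          thus ?thesis using comp y by simp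
        next
          case False
          hence "w \<le> y" using chainD[OF C'(1) w(1) y] by (auto simp: less_le)
          thus ?thesis using xw less_imp_le order_trans by blast
        qed
        hence "x \<in> C" using C'(1) by (intro C'(3) x') (simp add: chain_insert)
        thus ?thesis using xw by simp
      next
        assume xw: "w \<le> x"
        have "x \<le> y \<or> y \<le> x" if y: "y \<in> D" for y
        proof (cases "w \<le> y")
          case True
          thus ?thesis using comp y by simp
        next
          case False
          hence "y \<le> w" using chainD[OF D'(1) w(2) y] by blast
          thus ?thesis using xw order_trans by blast
        qed
        hence "x \<in> D" using D'(1) by (intro D'(3) x') (simp add: chain_insert)
        thus ?thesis using xw by simp
      qed
    qed
  qed (rule G(2))
  ultimately show ?thesis unfolding facets_def by blast
qed

lemma skipped_interval:
  fixes F :: "nat \<Rightarrow> ('a::{finite, order_bot, order_top}) set"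
  assumes lex: "lexicographic_order N F" and a: "a \<in> {1..N}" and b: "b \<in> {1..N}" and ab: "a < b"
  obtains c J where "c \<in> {1..<b}" "interval_in (F b) J" "F b - J \<subseteq> F c" "F a \<inter> J = {}"
proof -
  have bij: "bij_betw F {1..N} (facets order_complex)"
    using lex unfolding lexicographic_order_def by blast
  have facet: "F c \<in> facets order_complex" if "c \<in> {1..N}" for c
    using bij that by (auto simp: bij_betw_def)
  note Fa = facet_properties[OF facet[OF a]] and Fb = facet_properties[OF facet[OF b]]
  let ?rk = "\<lambda>c u. card {v \<in> F c. v \<le> u}"
  have "\<exists>j. at_rank (F a) j \<noteq> at_rank (F b) j"
  proof (rule ccontr)
    assume *: "\<not> ?thesis"
    have union: "F c = \<Union> (range (at_rank (F c)))" for c by (auto simp: at_rank_def)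
    have "at_rank (F a) = at_rank (F b)" using * by blast
    hence "F a = F b" using union[of a] union[of b] by simp
    hence "a = b" using inj_onD[OF bij_betw_imp_inj_on[OF bij]] a b by blast
    thus False using ab by simp
  qed
  then obtain j where j: "at_rank (F a) j \<noteq> at_rank (F b) j"
    and least: "\<And>l. l < j \<Longrightarrow> at_rank (F a) l = at_rank (F b) l"
    by (subst (asm) exists_least_iff) blast
  have "at_rank (F c) 0 = {}" for c by (auto simp: at_rank_def)
  then obtain i where i: "j = Suc i" using j by (metis not0_implies_Suc)
  have agree: "\<forall>l\<in>{1..i}. at_rank (F a) l = at_rank (F b) l" using least i by simp
  have ab_rank: "u \<in> F b \<and> ?rk b u = ?rk a u" if u: "u \<in> F a" "?rk a u \<le> i" for u
  proof -
    have "u \<in> at_rank (F b) (?rk a u)"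
      using at_rank_card[OF u(1)] least[of "?rk a u"] u(2) i by simp
    thus ?thesis by (simp add: at_rank_def)
  qed
  have ba_rank: "u \<in> F a \<and> ?rk a u = ?rk b u" if u: "u \<in> F b" "?rk b u \<le> i" for u
  proof -
    have "u \<in> at_rank (F a) (?rk b u)"
      using at_rank_card[OF u(1)] least[of "?rk b u"] u(2) i by simp
    thus ?thesis by (simp add: at_rank_def)
  qed
  define U where "U = {u \<in> F a \<inter> F b. i < ?rk b u}"
  show thesis
  proof (cases "U = {}")
    case True
    define J where "J = {u \<in> F b. i < ?rk b u}"
    show thesis
    proof (rule that[of a J])
      show "a \<in> {1..<b}" using a ab by simp
      show "interval_in (F b) J"
        unfolding interval_in_def J_def using rank_mono[of _ _ "F b"] by (auto intro: less_le_trans)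
      show "F b - J \<subseteq> F a" using ba_rank unfolding J_def by (blast intro: leI)
      show "F a \<inter> J = {}" using True unfolding J_def U_def by blast
    qed
  next
    case False
    have "Complete_Partial_Order.chain (\<le>) U"
      by (rule chain_subset[OF Fa(1)]) (auto simp: U_def)
    then obtain w where w: "w \<in> U" "\<And>u. u \<in> U \<Longrightarrow> w \<le> u"
      using finite_chain_least[OF _ False] by (metis finite)
    have wa: "w \<in> F a" and wb: "w \<in> F b" and w_rank: "i < ?rk b w"
      using w(1) by (auto simp: U_def)
    have w_rank': "i < ?rk a w"
      using w_rank ab_rank[OF wa] by (metis not_less)
    have below: "x \<le> w" if x: "x \<in> F a" "?rk a x \<le> i + 1" for x
    proof (rule ccontr)
      assume "\<not> x \<le> w"
      hence "w < x" using chainD[OF Fa(1) x(1) wa] by (auto simp: less_le)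
      from rank_strict_mono[OF x(1) this] show False using x(2) w_rank' by simp
    qed
    define J where "J = {u \<in> F b. i < ?rk b u \<and> u < w}"
    have "{x \<in> F a. x < w} \<union> {x \<in> F b. w \<le> x} \<in> F ` {1..N}"
      using splice_facets[OF facet[OF a] facet[OF b] wa wb] bij by (simp add: bij_betw_def)
    then obtain c where c: "c \<in> {1..N}" "F c = {x \<in> F a. x < w} \<union> {x \<in> F b. w \<le> x}"
      by auto
    have "(\<Union>j\<in>{1..i + 1}. at_rank (F a) j) \<subseteq> F c"
    proof
      fix x assume "x \<in> (\<Union>j\<in>{1..i + 1}. at_rank (F a) j)"
      hence x: "x \<in> F a" "?rk a x \<le> i + 1" by (auto simp: at_rank_def)
      show "x \<in> F c" using below[OF x] x(1) wb unfolding c(2) by (auto simp: less_le)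
    qed
    moreover have "(\<Union>j\<in>{1..i + 1}. at_rank (F b) j) \<subseteq> F b" by (auto simp: at_rank_def)
    moreover have "at_rank (F a) (i + 1) \<noteq> at_rank (F b) (i + 1)" using j i by simp
    ultimately have "c < b"
      using lex[unfolded lexicographic_order_def, THEN conjunct2, rule_format, OF a b, of i c b]
        ab agree c(1) b by blast
    show thesis
    proof (rule that[of c J])
      show "c \<in> {1..<b}" using c(1) \<open>c < b\<close> by simp
      show "interval_in (F b) J"
        unfolding interval_in_def J_def using rank_mono[of _ _ "F b"]
        by (auto intro: less_le_trans le_less_trans)
      show "F a \<inter> J = {}" using w(2) unfolding J_def U_def by fastforce
      show "F b - J \<subseteq> F c"
      proof
        fix u assume u: "u \<in> F b - J"
        show "u \<in> F c"
        proof (cases "?rk b u \<le> i")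
          case True
          have "u < w"
          proof (rule ccontr)
            assume "\<not> u < w"
            hence "w \<le> u" using chainD[OF Fb(1) wb, of u] u by (auto simp: less_le)
            from rank_mono[OF this, of "F b"] show False using True w_rank by simp
          qed
          thus ?thesis using ba_rank[OF _ True] u unfolding c(2) by blast
        next
          case False
          hence "\<not> u < w" using u unfolding J_def by auto
          hence "w \<le> u" using chainD[OF Fb(1) wb, of u] u by (auto simp: less_le)
          thus ?thesis using u unfolding c(2) by blast
        qed
      qed
    qed
  qed
qed

lemma betti_number_insert_empty: "betti_number d (insert {} K) = betti_number d K"
proof -
  have "simplices d (insert {} K) = simplices d K" for d by (auto simp: simplices_def)
  thus ?thesis
    by (simp add: betti_number_def simplicial_homology_group_def simplicial_chain_group_def
      simplicial_cycles_def simplicial_boundaries_def)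
qed

text \<open>
  Inserting the empty face changes no Betti number and makes the first facet a case like the others:
  all of \<open>F 1\<close> becomes a skipped interval.
\<close>

lemma betti_step_facet:
  fixes F :: "nat \<Rightarrow> ('a::{finite, order_bot, order_top}) set"
  assumes lex: "lexicographic_order N F" and k: "k \<in> {1..N}"
  shows "betti_step (insert {} (\<Union>i\<in>{1..<k}. Pow (F i))) (insert {} (\<Union>i\<in>{1..k}. Pow (F i)))"
    (is "betti_step ?K ?K'")
proof (rule betti_step_hitting_sets)
  have chain: "Complete_Partial_Order.chain (\<le>) (F i)" if "i \<in> {1..N}" for i
  proof (rule facet_properties(1))
    show "F i \<in> facets order_complex"
      using lex that bij_betwE unfolding lexicographic_order_def by blast
  qed
  have complex: "chain_complex (insert {} (\<Union>i\<in>I. Pow (F i)))" if "I \<subseteq> {1..N}" for I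
    unfolding chain_complex_def
  proof (intro ballI conjI allI impI)
    fix \<sigma> assume "\<sigma> \<in> insert {} (\<Union>i\<in>I. Pow (F i))"
    then consider "\<sigma> = {}" | i where "i \<in> I" "\<sigma> \<subseteq> F i" by blast
    thus "Complete_Partial_Order.chain (\<le>) \<sigma>"
    proof cases
      case 1
      thus ?thesis by (simp add: chain_empty)
    next
      case 2
      hence "i \<in> {1..N}" using that by blast
      thus ?thesis using chain_subset[OF chain 2(2)] by blast
    qed
  qed blast
  show "chain_complex ?K" "chain_complex ?K'" using k by (auto intro!: complex)
  show "Complete_Partial_Order.chain (\<le>) (F k)" using chain k by blast
  show "?K \<subseteq> ?K'" by auto
  show "{} \<in> ?K" "{} \<inter> F k = {}" by auto
  define \<I> where "\<I> = {J. interval_in (F k) J \<and> F k - J \<in> ?K}"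
  show "interval_in (F k) J" if "J \<in> \<I>" for J using that unfolding \<I>_def by blast
  have down: "\<tau> \<in> ?K" if "\<sigma> \<in> ?K" "\<tau> \<subseteq> \<sigma>" for \<sigma> \<tau> using that by auto
  have old: "\<sigma> \<in> ?K \<longleftrightarrow> (\<exists>J\<in>\<I>. \<sigma> \<inter> J = {})" if \<sigma>: "\<sigma> \<subseteq> F k" for \<sigma>
  proof
    assume "\<sigma> \<in> ?K"
    then consider "\<sigma> = {}" | i where "i \<in> {1..<k}" "\<sigma> \<subseteq> F i" by auto
    thus "\<exists>J\<in>\<I>. \<sigma> \<inter> J = {}"
    proof cases
      case 1
      have "F k \<in> \<I>" unfolding \<I>_def interval_in_def by auto
      thus ?thesis using 1 by blast
    next
      case 2
      have "i \<in> {1..N}" "i < k" using 2(1) k by auto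
      from skipped_interval[OF lex this(1) k this(2)] obtain c J where
        J: "c \<in> {1..<k}" "interval_in (F k) J" "F k - J \<subseteq> F c" "F i \<inter> J = {}" .
      have "J \<in> \<I>" using J(1-3) unfolding \<I>_def by blast
      thus ?thesis using J(4) 2(2) by blast
    qed
  next
    assume "\<exists>J\<in>\<I>. \<sigma> \<inter> J = {}"
    then obtain J where J: "F k - J \<in> ?K" "\<sigma> \<inter> J = {}" unfolding \<I>_def by blast
    show "\<sigma> \<in> ?K" by (rule down[OF J(1)]) (use \<sigma> J(2) in blast)
  qed
  have "hitting_sets (F k) \<I> = Pow (F k) - ?K"
  proof (rule Set.set_eqI)
    fix \<sigma>
    show "\<sigma> \<in> hitting_sets (F k) \<I> \<longleftrightarrow> \<sigma> \<in> Pow (F k) - ?K"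
      unfolding Diff_iff Pow_iff using old[of \<sigma>] by (simp add: hitting_sets_def) blast
  qed
  moreover have "?K' - ?K = Pow (F k) - ?K"
  proof -
    have "{1..k} = insert k {1..<k}" using k by auto
    hence "?K' = Pow (F k) \<union> ?K" by auto
    moreover have "P \<union> L - L = P - L" for P L :: "'a set set" by blast
    ultimately show ?thesis by (simp only:)
  qed
  ultimately show "?K' - ?K = (\<union>) {} ` hitting_sets (F k) \<I>" by simp
qed

theorem corollary2p2:
  fixes F :: "nat \<Rightarrow> ('a::{finite, order_bot, order_top}) set"
    and N k :: nat
  assumes "lexicographic_order N F"
    and "k \<in> {1..N}"
  shows "(\<exists>\<^sub>\<le>\<^sub>1 d. betti_number d (\<Union>i\<in>{1..k}. Pow (F i)) \<noteq> betti_number d (\<Union>i\<in>{1..<k}. Pow (F i)))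
    \<and> (\<forall>d. betti_number d (\<Union>i\<in>{1..k}. Pow (F i)) \<noteq> betti_number d (\<Union>i\<in>{1..<k}. Pow (F i)) \<longrightarrow>
          \<bar>int (betti_number d (\<Union>i\<in>{1..k}. Pow (F i)))
            - int (betti_number d (\<Union>i\<in>{1..<k}. Pow (F i)))\<bar> = 1)"
proof -
  let ?b = "\<lambda>d. betti_number d (\<Union>i\<in>{1..<k}. Pow (F i))"
    and ?b' = "\<lambda>d. betti_number d (\<Union>i\<in>{1..k}. Pow (F i))"
  obtain e where e: "\<And>d. d \<noteq> e \<Longrightarrow> ?b' d = ?b d" "\<bar>int (?b' e) - int (?b e)\<bar> \<le> 1"
    using betti_step_facet[OF assms] unfolding betti_step_def betti_number_insert_empty by blast
  have "\<bar>int (?b' d) - int (?b d)\<bar> = 1" if "?b' d \<noteq> ?b d" for d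
  proof -
    have "d = e" using that e(1) by blast
    show ?thesis using that e(2) unfolding \<open>d = e\<close> by linarith
  qed
  moreover have "\<exists>\<^sub>\<le>\<^sub>1 d. ?b' d \<noteq> ?b d"
    using e(1) by (intro Uniq_I) metis
  ultimately show ?thesis by blast
qed

end
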